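(* Let $(H,\mathcal{R})$ be a triangular Hopf algebra, $\mathcal{A}$ a braided commutative left $H$-module algebra, $\mathcal{M}$ an $H$-equivariant braided symmetric $\mathcal{A}$-bimodule, $\nabla^\mathcal{R}\colon\mathfrak{X}^1_\mathcal{R}(\mathcal{A})\otimes\mathcal{M}\to\mathcal{M}$ an equivariant covariant derivative with respect to $\mathcal{R}$, and $\mathcal{F}$ a Drinfel'd twist on $H$. The twisted equivariant covariant derivative $$\nabla^\mathcal{F}\colon\mathfrak{X}^1_\mathcal{R}(\mathcal{A})_\mathcal{F}\otimes_\mathcal{F}\mathcal{M}_\mathcal{F}\to\mathcal{M}_\mathcal{F},\qquad\nabla^\mathcal{F}_Xs=\nabla^\mathcal{R}_{\mathcal{F}_1^{-1}\rhd X}(\mathcal{F}_2^{-1}\rhd s),$$ is an equivariant covariant derivative (on the $H_\mathcal{F}$-equivariant braided symmetric $\mathcal{A}_\mathcal{F}$-bimodule $\mathcal{M}_\mathcal{F}$) with respect to the twisted triangular structure $\mathcal{R}_\mathcal{F}$, where $\mathfrak{X}^1_\mathcal{R}(\mathcal{A})_\mathcal{F}$ is identified with $\mathfrak{X}^1_{\mathcal{R}_\mathcal{F}}(\mathcal{A}_\mathcal{F})$ via $X\mapsto X^\mathcal{F}$.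
   Context: **Hopf algebras.** $\Bbbk$ is a commutative ring, $\otimes=\otimes_\Bbbk$, algebras are unital associative $\Bbbk$-algebras. A Hopf algebra $H$ has coproduct $\Delta(\xi)=\xi_{(1)}\otimes\xi_{(2)}$, counit $\epsilon$ and bijective antipode $S$. A triangular Hopf algebra $(H,\mathcal{R})$ is a Hopf algebra with an invertible $\mathcal{R}=\mathcal{R}_1\otimes\mathcal{R}_2\in H\otimes H$ (sums suppressed) such that $\mathcal{R}^{-1}=\mathcal{R}_{21}$, $\xi_{(2)}\otimes\xi_{(1)}=\mathcal{R}\Delta(\xi)\mathcal{R}^{-1}$, $(\Delta\otimes\mathrm{id})(\mathcal{R})=\mathcal{R}_{13}\mathcal{R}_{23}$, $(\mathrm{id}\otimes\Delta)(\mathcal{R})=\mathcal{R}_{13}\mathcal{R}_{12}$. Write $\mathcal{R}^{-1}=\mathcal{R}_1^{-1}\otimes\mathcal{R}_2^{-1}$. **Modules.** A left $H$-module algebra $\mathcal{A}$ satisfies $\xi\rhd(ab)=(\xi_{(1)}\rhd a)(\xi_{(2)}\rhd b)$, $\xi\rhd1=\epsilon(\xi)1$; it is braided commutative if $ba=(\mathcal{R}_1^{-1}\rhd a)(\mathcal{R}_2^{-1}\rhd b)$. An $H$-equivariant braided symmetric $\mathcal{A}$-bimodule $\mathcal{M}$ is an $\mathcal{A}$-bimodule and left $H$-module with $\xi\rhd(a\cdot m\cdot b)=(\xi_{(1)}\rhd a)\cdot(\xi_{(2)}\rhd m)\cdot(\xi_{(3)}\rhd b)$ and $m\cdot a=(\mathcal{R}_1^{-1}\rhd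 a)\cdot(\mathcal{R}_2^{-1}\rhd m)$. **Braided vector fields.** $\mathfrak{X}^1_\mathcal{R}(\mathcal{A})=\mathrm{Der}_\mathcal{R}(\mathcal{A})$ is the set of braided derivations: $\Bbbk$-linear $X\colon\mathcal{A}\to\mathcal{A}$ with $X(ab)=X(a)b+(\mathcal{R}_1^{-1}\rhd a)((\mathcal{R}_2^{-1}\rhd X)(b))$, where $H$ acts by the adjoint action $(\xi\rhd X)(a)=\xi_{(1)}\rhd(X(S(\xi_{(2)})\rhd a))$. It is an $H$-equivariant braided symmetric $\mathcal{A}$-bimodule with $(a\cdot X)(b)=a\,X(b)$ and $X\cdot a=(\mathcal{R}_1^{-1}\rhd a)\cdot(\mathcal{R}_2^{-1}\rhd X)$. Put $\mathscr{L}^\mathcal{R}_Xa=X(a)$. **Equivariant covariant derivative** on $\mathcal{M}$ with respect to $\mathcal{R}$: a $\Bbbk$-linear map $\nabla^\mathcal{R}\colon\mathfrak{X}^1_\mathcal{R}(\mathcal{A})\otimes\mathcal{M}\to\mathcal{M}$ which is $H$-equivariant, $\xi\rhd(\nabla^\mathcal{R}_Xs)=\nabla^\mathcal{R}_{\xi_{(1)}\rhd X}(\xi_{(2)}\rhd s)$, with $\nabla^\mathcal{R}_{a\cdot X}s=a\cdot(\nabla^\mathcal{R}_Xs)$ and $\nabla^\mathcal{R}_X(a\cdot s)=(\mathscr{L}^\mathcal{R}_Xa)\cdot s+(\mathcal{R}_1^{-1}\rhd a)\cdot(\nabla^\mathcal{R}_{\mathcal{R}_2^{-1}\rhd X}s)$.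 **Twists.** A (Drinfel'd) twist on $H$ is an invertible $\mathcal{F}=\mathcal{F}_1\otimes\mathcal{F}_2\in H\otimes H$ with $(\mathcal{F}\otimes1)(\Delta\otimes\mathrm{id})(\mathcal{F})=(1\otimes\mathcal{F})(\mathrm{id}\otimes\Delta)(\mathcal{F})$ and $(\epsilon\otimes\mathrm{id})(\mathcal{F})=1=(\mathrm{id}\otimes\epsilon)(\mathcal{F})$; write $\mathcal{F}^{-1}=\mathcal{F}_1^{-1}\otimes\mathcal{F}_2^{-1}$. $H_\mathcal{F}$ is the algebra $H$ with counit $\epsilon$, coproduct $\Delta_\mathcal{F}(\xi)=\mathcal{F}\Delta(\xi)\mathcal{F}^{-1}$, antipode $S_\mathcal{F}(\xi)=\beta S(\xi)\beta^{-1}$, $\beta=\mathcal{F}_1S(\mathcal{F}_2)$; it is triangular with $\mathcal{R}_\mathcal{F}=\mathcal{F}_{21}\mathcal{R}\mathcal{F}^{-1}$. $\otimes_\mathcal{F}$ is $\otimes$ with $H_\mathcal{F}$ acting via $\Delta_\mathcal{F}$. $\mathcal{A}_\mathcal{F}$ is $\mathcal{A}$ with the same action and product $a\cdot_\mathcal{F}b=(\mathcal{F}_1^{-1}\rhd a)(\mathcal{F}_2^{-1}\rhd b)$, a braided commutative left $H_\mathcal{F}$-module algebra. $\mathcal{M}_\mathcal{F}$ is the $H$-module $\mathcal{M}$ with $a\cdot_\mathcal{F}m=(\mathcal{F}_1^{-1}\rhd a)\cdot(\mathcal{F}_2^{-1}\rhd m)$, $m\cdot_\mathcal{F}a=(\mathcal{F}_1^{-1}\rhd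 m)\cdot(\mathcal{F}_2^{-1}\rhd a)$. The isomorphism $\mathfrak{X}^1_\mathcal{R}(\mathcal{A})_\mathcal{F}\cong\mathfrak{X}^1_{\mathcal{R}_\mathcal{F}}(\mathcal{A}_\mathcal{F})$ of $H_\mathcal{F}$-equivariant braided symmetric $\mathcal{A}_\mathcal{F}$-bimodules is $X\mapsto X^\mathcal{F}$, $X^\mathcal{F}(a)=(\mathcal{F}_1^{-1}\rhd X)(\mathcal{F}_2^{-1}\rhd a)$. Notions with respect to $\mathcal{R}_\mathcal{F}$ are those above with $(H,\mathcal{R},\mathcal{A})$ replaced by $(H_\mathcal{F},\mathcal{R}_\mathcal{F},\mathcal{A}_\mathcal{F})$. *)

theory Defs
  imports Complex_Main "HOL-Library.Multiset"
begin

section \<open>Tensor powers of a module\<close>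

text \<open>
  A \<open>k\<close>-module is given by its scalar multiplication \<open>s\<close> (locale \<^locale>\<open>module\<close>). A multiset of
  pairs stands for the formal sum of the corresponding pure tensors. The least congruence on the
  free commutative monoid of these sums that contains the relations below has the tensor product
  over \<open>k\<close> as its quotient; negatives need no separate treatment, as \<open>(-x) \<otimes> y\<close> is inverse to
  \<open>x \<otimes> y\<close>. An element of the tensor product is a congruence class, that is, a set of formal sums.
\<close>

inductive tensor2_rel ::
  "('k::comm_ring_1 \<Rightarrow> 'h::ab_group_add \<Rightarrow> 'h) \<Rightarrow> ('h \<times> 'h) multiset \<Rightarrow> ('h \<times> 'h) multiset \<Rightarrow> bool"
  for s where
  refl: "tensor2_rel s u u"
| sym: "tensor2_rel s u v \<Longrightarrow> tensor2_rel s v u"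
| trans: "tensor2_rel s u v \<Longrightarrow> tensor2_rel s v w \<Longrightarrow> tensor2_rel s u w"
| plus: "tensor2_rel s u v \<Longrightarrow> tensor2_rel s (u + w) (v + w)"
| zero: "tensor2_rel s {#(0, y)#} {#}"
| add1: "tensor2_rel s {#(x + x', y)#} {#(x, y), (x', y)#}"
| add2: "tensor2_rel s {#(x, y + y')#} {#(x, y), (x, y')#}"
| balanced: "tensor2_rel s {#(s c x, y)#} {#(x, s c y)#}"

inductive tensor3_rel ::
  "('k::comm_ring_1 \<Rightarrow> 'h::ab_group_add \<Rightarrow> 'h) \<Rightarrow>
    ('h \<times> 'h \<times> 'h) multiset \<Rightarrow> ('h \<times> 'h \<times> 'h) multiset \<Rightarrow> bool"
  for s where
  refl: "tensor3_rel s u u"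
| sym: "tensor3_rel s u v \<Longrightarrow> tensor3_rel s v u"
| trans: "tensor3_rel s u v \<Longrightarrow> tensor3_rel s v w \<Longrightarrow> tensor3_rel s u w"
| plus: "tensor3_rel s u v \<Longrightarrow> tensor3_rel s (u + w) (v + w)"
| zero: "tensor3_rel s {#(0, y, z)#} {#}"
| add1: "tensor3_rel s {#(x + x', y, z)#} {#(x, y, z), (x', y, z)#}"
| add2: "tensor3_rel s {#(x, y + y', z)#} {#(x, y, z), (x, y', z)#}"
| add3: "tensor3_rel s {#(x, y, z + z')#} {#(x, y, z), (x, y, z')#}"
| balanced12: "tensor3_rel s {#(s c x, y, z)#} {#(x, s c y, z)#}"
| balanced23: "tensor3_rel s {#(x, s c y, z)#} {#(x, y, s c z)#}"

definition class2 where "class2 s u = {v. tensor2_rel s u v}"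
definition class3 where "class3 s u = {v. tensor3_rel s u v}"

definition Tensor2 where "Tensor2 s = range (class2 s)"

text \<open>
  Sweedler-style summation \<open>f t\<^sub>1 t\<^sub>2\<close> over a tensor \<open>t = t\<^sub>1 \<otimes> t\<^sub>2\<close> (summation suppressed). The sum is
  taken over an arbitrary formal sum representing \<open>t\<close>; for a map \<open>f\<close> that is additive in each
  argument and balanced over \<open>k\<close> the choice is irrelevant, see \<open>sweedler_class2\<close>. Values in
  multisets are allowed, so that the same operation describes tensor-valued maps.
\<close>

definition sweedler :: "('h \<times> 'h) multiset set \<Rightarrow> ('h \<Rightarrow> 'h \<Rightarrow> 'b::comm_monoid_add) \<Rightarrow> 'b" where
  "sweedler t f = (\<Sum>(x, y)\<in>#(SOME u. u \<in> t). f x y)"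

definition sweedler3 ::
  "('h \<times> 'h \<times> 'h) multiset set \<Rightarrow> ('h \<Rightarrow> 'h \<Rightarrow> 'h \<Rightarrow> 'b::comm_monoid_add) \<Rightarrow> 'b" where
  "sweedler3 t f = (\<Sum>(x, y, z)\<in>#(SOME u. u \<in> t). f x y z)"

lemma sweedler_class2:
  fixes f :: "'h::ab_group_add \<Rightarrow> 'h \<Rightarrow> 'b::ab_group_add"
  assumes add1: "\<And>x x' y. f (x + x') y = f x y + f x' y"
    and add2: "\<And>x y y'. f x (y + y') = f x y + f x y'"
    and balanced: "\<And>c x y. f (s c x) y = f x (s c y)"
  shows "sweedler (class2 s u) f = (\<Sum>(x, y)\<in>#u. f x y)"
proof -
  have f0: "f 0 y = 0" for y
    using add1[of 0 0 y] by simp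
  have inv: "(\<Sum>(x, y)\<in>#v. f x y) = (\<Sum>(x, y)\<in>#w. f x y)" if "tensor2_rel s v w" for v w
    using that by induction (simp_all add: f0 add1 add2 balanced)
  have "(SOME v. v \<in> class2 s u) \<in> class2 s u"
    by (rule someI[of _ u]) (simp add: class2_def tensor2_rel.refl)
  then have "tensor2_rel s u (SOME v. v \<in> class2 s u)"
    by (simp add: class2_def)
  from inv[OF this] show ?thesis
    by (simp add: sweedler_def)
qed

lemma sweedler3_class3:
  fixes f :: "'h::ab_group_add \<Rightarrow> 'h \<Rightarrow> 'h \<Rightarrow> 'b::ab_group_add"
  assumes add1: "\<And>x x' y z. f (x + x') y z = f x y z + f x' y z"
    and add2: "\<And>x y y' z. f x (y + y') z = f x y z + f x y' z"
    and add3: "\<And>x y z z'. f x y (z + z') = f x y z + f x y z'"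
    and balanced12: "\<And>c x y z. f (s c x) y z = f x (s c y) z"
    and balanced23: "\<And>c x y z. f x (s c y) z = f x y (s c z)"
  shows "sweedler3 (class3 s u) f = (\<Sum>(x, y, z)\<in>#u. f x y z)"
proof -
  have f0: "f 0 y z = 0" for y z
    using add1[of 0 0 y z] by simp
  have inv: "(\<Sum>(x, y, z)\<in>#v. f x y z) = (\<Sum>(x, y, z)\<in>#w. f x y z)" if "tensor3_rel s v w" for v w
    using that by induction (simp_all add: f0 add1 add2 add3 balanced12 balanced23)
  have "(SOME v. v \<in> class3 s u) \<in> class3 s u"
    by (rule someI[of _ u]) (simp add: class3_def tensor3_rel.refl)
  then have "tensor3_rel s u (SOME v. v \<in> class3 s u)"
    by (simp add: class3_def)
  from inv[OF this] show ?thesis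
    by (simp add: sweedler3_def)
qed

definition tensor2_add where
  "tensor2_add s t t' =
    class2 s (sweedler t (\<lambda>x y. {#(x, y)#}) + sweedler t' (\<lambda>x y. {#(x, y)#}))"

definition tensor2_scale where
  "tensor2_scale s c t = class2 s (sweedler t (\<lambda>x y. {#(s c x, y)#}))"

definition flip where
  "flip s t = class2 s (sweedler t (\<lambda>x y. {#(y, x)#}))"

text \<open>The algebra structure of the second and third tensor power of an algebra.\<close>

definition one2 :: "('k::comm_ring_1 \<Rightarrow> 'h::ring_1 \<Rightarrow> 'h) \<Rightarrow> ('h \<times> 'h) multiset set" where
  "one2 s = class2 s {#(1, 1)#}"

definition mult2 ::
  "('k::comm_ring_1 \<Rightarrow> 'h::ring_1 \<Rightarrow> 'h) \<Rightarrow>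
    ('h \<times> 'h) multiset set \<Rightarrow> ('h \<times> 'h) multiset set \<Rightarrow> ('h \<times> 'h) multiset set" where
  "mult2 s t t' = class2 s (sweedler t (\<lambda>a b. sweedler t' (\<lambda>c d. {#(a * c, b * d)#})))"

definition mult3 ::
  "('k::comm_ring_1 \<Rightarrow> 'h::ring_1 \<Rightarrow> 'h) \<Rightarrow>
    ('h \<times> 'h \<times> 'h) multiset set \<Rightarrow> ('h \<times> 'h \<times> 'h) multiset set \<Rightarrow> ('h \<times> 'h \<times> 'h) multiset set"
  where
  "mult3 s t t' =
    class3 s (sweedler3 t (\<lambda>a b c. sweedler3 t' (\<lambda>a' b' c'. {#(a * a', b * b', c * c')#})))"

definition is_inverse2 where
  "is_inverse2 s t t' \<longleftrightarrow> t' \<in> Tensor2 s \<and> mult2 s t t' = one2 s \<and> mult2 s t' t = one2 s"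

definition invertible2 where
  "invertible2 s t \<longleftrightarrow> t \<in> Tensor2 s \<and> (\<exists>t'. is_inverse2 s t t')"

definition inv2 where
  "inv2 s t = (THE t'. is_inverse2 s t t')"

text \<open>For \<open>t \<in> H \<otimes> H\<close>: the elements \<open>t\<^sub>1\<^sub>2 = t \<otimes> 1\<close>, \<open>t\<^sub>1\<^sub>3\<close> and \<open>t\<^sub>2\<^sub>3 = 1 \<otimes> t\<close> of \<open>H \<otimes> H \<otimes> H\<close>.\<close>

definition leg12 :: "('k::comm_ring_1 \<Rightarrow> 'h::ring_1 \<Rightarrow> 'h) \<Rightarrow> _" where
  "leg12 s t = class3 s (sweedler t (\<lambda>x y. {#(x, y, 1)#}))"

definition leg13 :: "('k::comm_ring_1 \<Rightarrow> 'h::ring_1 \<Rightarrow> 'h) \<Rightarrow> _" where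
  "leg13 s t = class3 s (sweedler t (\<lambda>x y. {#(x, 1, y)#}))"

definition leg23 :: "('k::comm_ring_1 \<Rightarrow> 'h::ring_1 \<Rightarrow> 'h) \<Rightarrow> _" where
  "leg23 s t = class3 s (sweedler t (\<lambda>x y. {#(1, x, y)#}))"

section \<open>Triangular Hopf algebras\<close>

definition k_bilinear where
  "k_bilinear s1 s2 s3 f \<longleftrightarrow>
    (\<forall>y. module_hom s1 s3 (\<lambda>x. f x y)) \<and> (\<forall>x. module_hom s2 s3 (\<lambda>y. f x y))"

text \<open>
  The ring structure of a Hopf algebra is that of the type \<open>'h\<close>; a twist does not change it.
\<close>

record ('k, 'h) hopf_data =
  hscale :: "'k \<Rightarrow> 'h \<Rightarrow> 'h"
  comult :: "'h \<Rightarrow> ('h \<times> 'h) multiset set"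
  counit :: "'h \<Rightarrow> 'k"
  antipode :: "'h \<Rightarrow> 'h"

text \<open>\<open>\<Delta> \<otimes> id\<close> and \<open>id \<otimes> \<Delta>\<close> as maps from \<open>H \<otimes> H\<close> to \<open>H \<otimes> H \<otimes> H\<close>.\<close>

definition comult_id :: "('k::comm_ring_1, 'h::ring_1) hopf_data \<Rightarrow> _" where
  "comult_id H t =
    class3 (hscale H) (sweedler t (\<lambda>x y. sweedler (comult H x) (\<lambda>u v. {#(u, v, y)#})))"

definition id_comult :: "('k::comm_ring_1, 'h::ring_1) hopf_data \<Rightarrow> _" where
  "id_comult H t =
    class3 (hscale H) (sweedler t (\<lambda>x y. sweedler (comult H y) (\<lambda>u v. {#(x, u, v)#})))"

locale hopf_algebra =
  fixes H :: "('k::comm_ring_1, 'h::ring_1) hopf_data"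
  assumes mult_bilinear: "k_bilinear (hscale H) (hscale H) (hscale H) (*)"
    and comult_in: "comult H x \<in> Tensor2 (hscale H)"
    and comult_add: "comult H (x + y) = tensor2_add (hscale H) (comult H x) (comult H y)"
    and comult_scale: "comult H (hscale H c x) = tensor2_scale (hscale H) c (comult H x)"
    and comult_mult: "comult H (x * y) = mult2 (hscale H) (comult H x) (comult H y)"
    and comult_one: "comult H 1 = one2 (hscale H)"
    and coassoc: "comult_id H (comult H x) = id_comult H (comult H x)"
    and counit_linear: "module_hom (hscale H) (*) (counit H)"
    and counit_mult: "counit H (x * y) = counit H x * counit H y"
    and counit_one: "counit H 1 = 1"
    and counit_left: "sweedler (comult H x) (\<lambda>u v. hscale H (counit H u) v) = x"
    and counit_right: "sweedler (comult H x) (\<lambda>u v. hscale H (counit H v) u) = x"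
    and antipode_linear: "module_hom (hscale H) (hscale H) (antipode H)"
    and antipode_bij: "bij (antipode H)"
    and antipode_left: "sweedler (comult H x) (\<lambda>u v. antipode H u * v) = hscale H (counit H x) 1"
    and antipode_right: "sweedler (comult H x) (\<lambda>u v. u * antipode H v) = hscale H (counit H x) 1"

locale triangular_hopf_algebra = hopf_algebra H
  for H :: "('k::comm_ring_1, 'h::ring_1) hopf_data" +
  fixes R :: "('h \<times> 'h) multiset set"
  assumes R_invertible: "invertible2 (hscale H) R"
    and R_triangular: "inv2 (hscale H) R = flip (hscale H) R"
    and R_comult: "flip (hscale H) (comult H x) =
      mult2 (hscale H) (mult2 (hscale H) R (comult H x)) (inv2 (hscale H) R)"
    and R_comult_id: "comult_id H R = mult3 (hscale H) (leg13 (hscale H) R) (leg23 (hscale H) R)"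
    and R_id_comult: "id_comult H R = mult3 (hscale H) (leg13 (hscale H) R) (leg12 (hscale H) R)"

section \<open>Module algebras and bimodules\<close>

definition left_module ::
  "('k::comm_ring_1, 'h::ring_1) hopf_data \<Rightarrow> ('k \<Rightarrow> 'm::ab_group_add \<Rightarrow> 'm) \<Rightarrow>
    ('h \<Rightarrow> 'm \<Rightarrow> 'm) \<Rightarrow> bool" where
  "left_module H s act \<longleftrightarrow> k_bilinear (hscale H) s s act \<and>
    (\<forall>m. act 1 m = m) \<and> (\<forall>x y m. act (x * y) m = act x (act y m))"

text \<open>
  The product of \<open>A\<close> is a component of the structure, not the product of a type class, because
  \<open>A\<close> and its twisted version have the same underlying module.
\<close>

record ('k, 'h, 'a) algebra_data =
  ascale :: "'k \<Rightarrow> 'a \<Rightarrow> 'a"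
  amult :: "'a \<Rightarrow> 'a \<Rightarrow> 'a"
  aone :: "'a"
  aact :: "'h \<Rightarrow> 'a \<Rightarrow> 'a"

locale module_algebra = hopf_algebra H
  for H :: "('k::comm_ring_1, 'h::ring_1) hopf_data" +
  fixes A :: "('k, 'h, 'a::ab_group_add) algebra_data"
  assumes amult_bilinear: "k_bilinear (ascale A) (ascale A) (ascale A) (amult A)"
    and amult_assoc: "amult A (amult A a b) c = amult A a (amult A b c)"
    and aone_left: "amult A (aone A) a = a"
    and aone_right: "amult A a (aone A) = a"
    and aact_module: "left_module H (ascale A) (aact A)"
    and aact_mult: "aact A x (amult A a b) =
      sweedler (comult H x) (\<lambda>u v. amult A (aact A u a) (aact A v b))"
    and aact_one: "aact A x (aone A) = ascale A (counit H x) (aone A)"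

locale braided_commutative_module_algebra = triangular_hopf_algebra H R + module_algebra H A
  for H :: "('k::comm_ring_1, 'h::ring_1) hopf_data" and R
    and A :: "('k, 'h, 'a::ab_group_add) algebra_data" +
  assumes braided_commutative: "amult A b a =
      sweedler (inv2 (hscale H) R) (\<lambda>u v. amult A (aact A u a) (aact A v b))"

record ('k, 'h, 'a, 'm) bimodule_data =
  mscale :: "'k \<Rightarrow> 'm \<Rightarrow> 'm"
  lmult :: "'a \<Rightarrow> 'm \<Rightarrow> 'm"
  rmult :: "'m \<Rightarrow> 'a \<Rightarrow> 'm"
  mact :: "'h \<Rightarrow> 'm \<Rightarrow> 'm"

locale equivariant_braided_symmetric_bimodule = braided_commutative_module_algebra H R A
  for H :: "('k::comm_ring_1, 'h::ring_1) hopf_data" and R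
    and A :: "('k, 'h, 'a::ab_group_add) algebra_data" +
  fixes M :: "('k, 'h, 'a, 'm::ab_group_add) bimodule_data"
  assumes lmult_bilinear: "k_bilinear (ascale A) (mscale M) (mscale M) (lmult M)"
    and rmult_bilinear: "k_bilinear (mscale M) (ascale A) (mscale M) (rmult M)"
    and lmult_mult: "lmult M (amult A a b) m = lmult M a (lmult M b m)"
    and lmult_one: "lmult M (aone A) m = m"
    and rmult_mult: "rmult M m (amult A a b) = rmult M (rmult M m a) b"
    and rmult_one: "rmult M m (aone A) = m"
    and lmult_rmult: "rmult M (lmult M a m) b = lmult M a (rmult M m b)"
    and mact_module: "left_module H (mscale M) (mact M)"
    and mact_equivariant: "mact M x (rmult M (lmult M a m) b) =
      sweedler3 (comult_id H (comult H x))
        (\<lambda>u v w. rmult M (lmult M (aact A u a) (mact M v m)) (aact A w b))"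
    and braided_symmetric: "rmult M m a =
      sweedler (inv2 (hscale H) R) (\<lambda>u v. lmult M (aact A u a) (mact M v m))"

section \<open>Braided vector fields and covariant derivatives\<close>

definition adjoint_action ::
  "('k::comm_ring_1, 'h::ring_1) hopf_data \<Rightarrow> ('k, 'h, 'a::ab_group_add) algebra_data \<Rightarrow>
    'h \<Rightarrow> ('a \<Rightarrow> 'a) \<Rightarrow> 'a \<Rightarrow> 'a" where
  "adjoint_action H A x X a =
    sweedler (comult H x) (\<lambda>u v. aact A u (X (aact A (antipode H v) a)))"

definition braided_vector_fields ::
  "('k::comm_ring_1, 'h::ring_1) hopf_data \<Rightarrow> ('h \<times> 'h) multiset set \<Rightarrow>
    ('k, 'h, 'a::ab_group_add) algebra_data \<Rightarrow> ('a \<Rightarrow> 'a) set" where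
  "braided_vector_fields H R A = {X. module_hom (ascale A) (ascale A) X \<and>
    (\<forall>a b. X (amult A a b) = amult A (X a) b +
      sweedler (inv2 (hscale H) R) (\<lambda>u v. amult A (aact A u a) (adjoint_action H A v X b)))}"

text \<open>
  A covariant derivative, a \<open>k\<close>-linear map on the tensor product of vector fields and \<open>M\<close>, is
  given as the corresponding \<open>k\<close>-bilinear map. Only its values on braided vector fields matter.
\<close>

locale equivariant_covariant_derivative = equivariant_braided_symmetric_bimodule H R A M
  for H :: "('k::comm_ring_1, 'h::ring_1) hopf_data" and R
    and A :: "('k, 'h, 'a::ab_group_add) algebra_data"
    and M :: "('k, 'h, 'a, 'm::ab_group_add) bimodule_data" +
  fixes nabla :: "('a \<Rightarrow> 'a) \<Rightarrow> 'm \<Rightarrow> 'm"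
  assumes nabla_linear: "X \<in> braided_vector_fields H R A \<Longrightarrow>
      module_hom (mscale M) (mscale M) (nabla X)"
    and nabla_add: "X \<in> braided_vector_fields H R A \<Longrightarrow> Y \<in> braided_vector_fields H R A \<Longrightarrow>
      nabla (\<lambda>a. X a + Y a) m = nabla X m + nabla Y m"
    and nabla_scale: "X \<in> braided_vector_fields H R A \<Longrightarrow>
      nabla (\<lambda>a. ascale A c (X a)) m = mscale M c (nabla X m)"
    and nabla_equivariant: "X \<in> braided_vector_fields H R A \<Longrightarrow>
      mact M x (nabla X m) =
        sweedler (comult H x) (\<lambda>u v. nabla (adjoint_action H A u X) (mact M v m))"
    and nabla_lmult: "X \<in> braided_vector_fields H R A \<Longrightarrow>
      nabla (\<lambda>b. amult A a (X b)) m = lmult M a (nabla X m)"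
    and nabla_leibniz: "X \<in> braided_vector_fields H R A \<Longrightarrow>
      nabla X (lmult M a m) = lmult M (X a) m +
        sweedler (inv2 (hscale H) R)
          (\<lambda>u v. lmult M (aact A u a) (nabla (adjoint_action H A v X) m))"

section \<open>Drinfel'd twists\<close>

locale drinfeld_twist = hopf_algebra H
  for H :: "('k::comm_ring_1, 'h::ring_1) hopf_data" +
  fixes F :: "('h \<times> 'h) multiset set"
  assumes F_invertible: "invertible2 (hscale H) F"
    and F_cocycle: "mult3 (hscale H) (leg12 (hscale H) F) (comult_id H F) =
      mult3 (hscale H) (leg23 (hscale H) F) (id_comult H F)"
    and F_counit_left: "sweedler F (\<lambda>u v. hscale H (counit H u) v) = 1"
    and F_counit_right: "sweedler F (\<lambda>u v. hscale H (counit H v) u) = 1"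

definition twist_element ::
  "('k::comm_ring_1, 'h::ring_1) hopf_data \<Rightarrow> ('h \<times> 'h) multiset set \<Rightarrow> 'h" where
  "twist_element H F = sweedler F (\<lambda>u v. u * antipode H v)"

definition twist_hopf ::
  "('k::comm_ring_1, 'h::ring_1) hopf_data \<Rightarrow> ('h \<times> 'h) multiset set \<Rightarrow> ('k, 'h) hopf_data" where
  "twist_hopf H F = H\<lparr>
    comult := (\<lambda>x. mult2 (hscale H) (mult2 (hscale H) F (comult H x)) (inv2 (hscale H) F)),
    antipode := (\<lambda>x. twist_element H F * antipode H x *
      (THE b. twist_element H F * b = 1 \<and> b * twist_element H F = 1))\<rparr>"

definition twist_R ::
  "('k::comm_ring_1, 'h::ring_1) hopf_data \<Rightarrow> ('h \<times> 'h) multiset set \<Rightarrow>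
    ('h \<times> 'h) multiset set \<Rightarrow> ('h \<times> 'h) multiset set" where
  "twist_R H F R =
    mult2 (hscale H) (mult2 (hscale H) (flip (hscale H) F) R) (inv2 (hscale H) F)"

definition twist_algebra ::
  "('k::comm_ring_1, 'h::ring_1) hopf_data \<Rightarrow> ('h \<times> 'h) multiset set \<Rightarrow>
    ('k, 'h, 'a::ab_group_add) algebra_data \<Rightarrow> ('k, 'h, 'a) algebra_data" where
  "twist_algebra H F A = A\<lparr>
    amult := (\<lambda>a b. sweedler (inv2 (hscale H) F) (\<lambda>u v. amult A (aact A u a) (aact A v b)))\<rparr>"

definition twist_bimodule ::
  "('k::comm_ring_1, 'h::ring_1) hopf_data \<Rightarrow> ('h \<times> 'h) multiset set \<Rightarrow>
    ('k, 'h, 'a::ab_group_add) algebra_data \<Rightarrow> ('k, 'h, 'a, 'm::ab_group_add) bimodule_data \<Rightarrow>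
    ('k, 'h, 'a, 'm) bimodule_data" where
  "twist_bimodule H F A M = M\<lparr>
    lmult := (\<lambda>a m. sweedler (inv2 (hscale H) F) (\<lambda>u v. lmult M (aact A u a) (mact M v m))),
    rmult := (\<lambda>m a. sweedler (inv2 (hscale H) F) (\<lambda>u v. rmult M (mact M u m) (aact A v a)))\<rparr>"

text \<open>The map \<open>X \<mapsto> X\<^sup>F\<close> from vector fields on \<open>A\<close> to vector fields on the twisted algebra.\<close>

definition twist_vector_field ::
  "('k::comm_ring_1, 'h::ring_1) hopf_data \<Rightarrow> ('h \<times> 'h) multiset set \<Rightarrow>
    ('k, 'h, 'a::ab_group_add) algebra_data \<Rightarrow> ('a \<Rightarrow> 'a) \<Rightarrow> 'a \<Rightarrow> 'a" where
  "twist_vector_field H F A X a =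
    sweedler (inv2 (hscale H) F) (\<lambda>u v. adjoint_action H A u X (aact A v a))"

definition twist_nabla ::
  "('k::comm_ring_1, 'h::ring_1) hopf_data \<Rightarrow> ('h \<times> 'h) multiset set \<Rightarrow>
    ('k, 'h, 'a::ab_group_add) algebra_data \<Rightarrow> ('k, 'h, 'a, 'm::ab_group_add) bimodule_data \<Rightarrow>
    (('a \<Rightarrow> 'a) \<Rightarrow> 'm \<Rightarrow> 'm) \<Rightarrow> ('a \<Rightarrow> 'a) \<Rightarrow> 'm \<Rightarrow> 'm" where
  "twist_nabla H F A M nabla X m =
    sweedler (inv2 (hscale H) F) (\<lambda>u v. nabla (adjoint_action H A u X) (mact M v m))"

end

theory Submission
  imports Defs
begin

text \<open>
  All Sweedler sums are values of multilinear maps at elements of \<open>H \<otimes> H\<close> or \<open>H \<otimes> H \<otimes> H\<close>, so that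
  identities between twisted structures follow from identities between words in \<open>\<F>\<close>, \<open>\<R>\<close> and
  their images under coproducts and flips. With \<open>\<G> = \<F>\<^sup>-\<^sup>1\<close> the essential ones are the cocycle identity
  \<open>(\<Delta> \<otimes> id)(\<G>) \<G>\<^sub>1\<^sub>2 = (id \<otimes> \<Delta>)(\<G>) \<G>\<^sub>2\<^sub>3\<close>, \<open>\<G> \<Delta>\<^sub>\<F>(\<xi>) = \<Delta>(\<xi>) \<G>\<close> and
  \<open>\<G> \<R>\<^sub>\<F>\<^sup>-\<^sup>1 = \<R>\<^sup>-\<^sup>1 \<G>\<^sub>2\<^sub>1\<close>. Linearity, equivariance and the Leibniz rule of the twisted
  derivative are obtained from them. Evaluation \<open>(X, a) \<mapsto> X a\<close> is itself an equivariant covariant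
  derivative on \<open>A\<close>, whose twist is \<open>X \<mapsto> X\<^sup>F\<close>; the same results therefore show that \<open>X\<^sup>F\<close> is
  a braided derivation and that the map intertwines the adjoint actions. Its inverse is the
  corresponding map for the twist \<open>\<G>\<close> of \<open>H\<^sub>\<F>\<close>, which leads back to \<open>H\<close>.
\<close>

section \<open>A universal module for tensor identities\<close>

text \<open>The obstacle is the antipode of H_F: it contains \<beta> and would enter every adjoint
  action on twisted fields. It is confined to the proof that H_F is a Hopf algebra; afterwards the
  adjoint action is recognised by the equivariance of evaluation, which mentions no antipode. This
  works because x \<otimes> n \<mapsto> x1 \<otimes> x2 n is invertible, so that a bilinear map
  vanishing on its image is zero. The same cancellation gives antimultiplicativity and uniqueness of
  the antipode and the stability of braided derivations under the adjoint action. In the Leibniz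
  rule the braiding acts on the coefficient and the field, while equivariance splits the coefficient
  and the module element. The cocycle identity is therefore needed twice, to regroup before R is
  exchanged for R_F and to restore the grouping afterwards. Twisting back has to give equal records,
  not merely isomorphic structures; only then do results about H_F, A_F and the inverse twist turn
  into results about H and A.\<close>

text \<open>
  Equalities of tensors are to be tested on multilinear maps with values in a module, and Sweedler
  sums need values in a type of class \<open>ab_group_add\<close>. The tensor products themselves depend on the
  scalar multiplication and form no type; the product of all quotients of the formal sums over all
  presentations is a type, and it contains every tensor product.
\<close>

locale module_presentation =
  fixes r :: "'p multiset \<Rightarrow> 'p multiset \<Rightarrow> bool"
    and \<sigma> :: "'k::comm_ring_1 \<Rightarrow> 'p multiset \<Rightarrow> 'p multiset"
  assumes equiv: "equivp r"
    and plus_left: "r u v \<Longrightarrow> r (u + w) (v + w)"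
    and scale_cong: "r u v \<Longrightarrow> r (\<sigma> c u) (\<sigma> c v)"
    and scale_plus: "r (\<sigma> c (u + v)) (\<sigma> c u + \<sigma> c v)"
    and plus_scale: "r (\<sigma> (c + d) u) (\<sigma> c u + \<sigma> d u)"
    and scale_scale: "r (\<sigma> c (\<sigma> d u)) (\<sigma> (c * d) u)"
    and scale_one: "r (\<sigma> 1 u) u"
    and scale_zero: "r (\<sigma> 0 u) {#}"
begin

lemma refl: "r u u"
  using equiv by (rule equivp_reflp)

lemma sym: "r u v \<Longrightarrow> r v u"
  using equiv by (rule equivp_symp)

lemma trans: "r u v \<Longrightarrow> r v w \<Longrightarrow> r u w"
  using equiv by (rule equivp_transp)

lemma plus_cong: "r u u' \<Longrightarrow> r v v' \<Longrightarrow> r (u + v) (u' + v')"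
  by (metis add.commute plus_left trans)

text \<open>Needed for \<open>of_formal_scale\<close>: an embedded sum is empty in all coordinates
  but one, and these must stay zero under scaling. As \<open>scale_zero\<close> is the only axiom
  producing the empty sum, that sum is first replaced by 0 times itself.\<close>

lemma scale_empty: "r (\<sigma> c {#}) {#}"
proof -
  have "r (\<sigma> c {#}) (\<sigma> c (\<sigma> 0 {#}))"
    by (rule scale_cong[OF sym[OF scale_zero]])
  moreover have "r (\<sigma> c (\<sigma> 0 {#})) (\<sigma> (c * 0) {#})"
    by (rule scale_scale)
  ultimately show ?thesis
    using scale_zero[of "{#}"] trans by (metis mult_zero_right)
qed

lemma scale_minus_one: "r (\<sigma> (- 1) u + u) {#}"
proof -
  have "r (\<sigma> (- 1) u + u) (\<sigma> (- 1) u + \<sigma> 1 u)"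
    by (intro plus_cong refl sym[OF scale_one])
  moreover have "r (\<sigma> (- 1) u + \<sigma> 1 u) (\<sigma> (- 1 + 1) u)"
    by (rule sym[OF plus_scale])
  ultimately show ?thesis
    using scale_zero[of u] trans by simp
qed

end

\<comment> \<open>A representative is a family of formal sums indexed by all pairs
  \<open>(r, \<sigma>)\<close>. Equality looks only at the indices that are presentations, so values
  elsewhere are invisible. The type depends on the scalars and generators, never on a particular
  scalar multiplication.\<close>
quotient_type (overloaded) ('k, 'p) universal_module =
  "('p multiset \<Rightarrow> 'p multiset \<Rightarrow> bool) \<times> ('k::comm_ring_1 \<Rightarrow> 'p multiset \<Rightarrow> 'p multiset) \<Rightarrow> 'p multiset"
  / "\<lambda>g h. \<forall>r \<sigma>. module_presentation r \<sigma> \<longrightarrow> r (g (r, \<sigma>)) (h (r, \<sigma>))"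
proof (intro equivpI reflpI sympI transpI allI impI)
  fix g h k :: "('p multiset \<Rightarrow> 'p multiset \<Rightarrow> bool) \<times> ('k \<Rightarrow> 'p multiset \<Rightarrow> 'p multiset) \<Rightarrow> 'p multiset"
    and r and \<sigma> :: "'k \<Rightarrow> 'p multiset \<Rightarrow> 'p multiset"
  assume "module_presentation r \<sigma>"
  then interpret module_presentation r \<sigma> .
  show "r (g (r, \<sigma>)) (g (r, \<sigma>))"
    by (rule refl)
  assume gh: "\<forall>r \<sigma>. module_presentation r \<sigma> \<longrightarrow> r (g (r, \<sigma>)) (h (r, \<sigma>))"
  then have "r (g (r, \<sigma>)) (h (r, \<sigma>))"
    using module_presentation_axioms by blast
  then show "r (h (r, \<sigma>)) (g (r, \<sigma>))"
    by (rule sym)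
  assume "\<forall>r \<sigma>. module_presentation r \<sigma> \<longrightarrow> r (h (r, \<sigma>)) (k (r, \<sigma>))"
  then have "r (h (r, \<sigma>)) (k (r, \<sigma>))"
    using module_presentation_axioms by blast
  with \<open>r (g (r, \<sigma>)) (h (r, \<sigma>))\<close> show "r (g (r, \<sigma>)) (k (r, \<sigma>))"
    by (rule trans)
qed

lift_definition universal_scale ::
  "'k::comm_ring_1 \<Rightarrow> ('k, 'p) universal_module \<Rightarrow> ('k, 'p) universal_module"
  is "\<lambda>c g (r, \<sigma>). \<sigma> c (g (r, \<sigma>))"
  by (auto intro: module_presentation.scale_cong)

instantiation universal_module :: (comm_ring_1, type) ab_group_add
begin

lift_definition zero_universal_module :: "('a, 'b) universal_module" is "\<lambda>i. {#}" .

lift_definition plus_universal_module ::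
  "('a, 'b) universal_module \<Rightarrow> ('a, 'b) universal_module \<Rightarrow> ('a, 'b) universal_module"
  is "\<lambda>g h i. g i + h i"
proof -
  fix g g' h h' :: "('b multiset \<Rightarrow> 'b multiset \<Rightarrow> bool) \<times> ('a \<Rightarrow> 'b multiset \<Rightarrow> 'b multiset) \<Rightarrow> 'b multiset"
    and r and \<sigma> :: "'a \<Rightarrow> 'b multiset \<Rightarrow> 'b multiset"
  assume "\<And>r \<sigma>. module_presentation r \<sigma> \<Longrightarrow> r (g (r, \<sigma>)) (g' (r, \<sigma>))"
    "\<And>r \<sigma>. module_presentation r \<sigma> \<Longrightarrow> r (h (r, \<sigma>)) (h' (r, \<sigma>))"
    and p: "module_presentation r \<sigma>"
  then have "r (g (r, \<sigma>)) (g' (r, \<sigma>))" "r (h (r, \<sigma>)) (h' (r, \<sigma>))"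
    by blast+
  then show "r (g (r, \<sigma>) + h (r, \<sigma>)) (g' (r, \<sigma>) + h' (r, \<sigma>))"
    by (rule module_presentation.plus_cong[OF p])
qed

text \<open>Formal sums have no negatives; the scalar -1 supplies them.\<close>

definition uminus_universal_module ::
  "('a, 'b) universal_module \<Rightarrow> ('a, 'b) universal_module" where
  "uminus_universal_module = universal_scale (- 1)"

definition minus_universal_module ::
  "('a, 'b) universal_module \<Rightarrow> ('a, 'b) universal_module \<Rightarrow> ('a, 'b) universal_module" where
  "minus_universal_module g h = g + universal_scale (- 1) h"

instance
proof
  fix g h k :: "('a, 'b) universal_module"
  show "g + h + k = g + (h + k)"
    by transfer (simp add: add.assoc module_presentation.refl)
  show "g + h = h + g"
    by transfer (simp add: add.commute module_presentation.refl)
  show "0 + g = g"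
    by transfer (simp add: module_presentation.refl)
  show "g - h = g + - h"
    by (simp add: minus_universal_module_def uminus_universal_module_def)
  show "- g + g = 0"
    unfolding uminus_universal_module_def
    by transfer (simp add: module_presentation.scale_minus_one)
qed

end

lemma module_universal_scale [simp]: "module universal_scale"
proof
  fix c d :: "'k::comm_ring_1" and g h :: "('k, 'p) universal_module"
  show "universal_scale c (g + h) = universal_scale c g + universal_scale c h"
    by transfer (simp add: module_presentation.scale_plus)
  show "universal_scale (c + d) g = universal_scale c g + universal_scale d g"
    by transfer (simp add: module_presentation.plus_scale)
  show "universal_scale c (universal_scale d g) = universal_scale (c * d) g"
    by transfer (simp add: module_presentation.scale_scale)
  show "universal_scale 1 g = g"
    by transfer (simp add: module_presentation.scale_one)
qed

lift_definition of_formal ::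
  "('p multiset \<Rightarrow> 'p multiset \<Rightarrow> bool) \<Rightarrow> ('k::comm_ring_1 \<Rightarrow> 'p multiset \<Rightarrow> 'p multiset) \<Rightarrow>
    'p multiset \<Rightarrow> ('k, 'p) universal_module"
  is "\<lambda>r \<sigma> u i. if i = (r, \<sigma>) then u else {#}" .

text \<open>The coordinate \<open>(r, \<sigma>)\<close> detects \<open>r\<close>; in all others both
  sides are empty sums.\<close>

lemma of_formal_eq_iff:
  assumes "module_presentation r \<sigma>"
  shows "of_formal r \<sigma> u = of_formal r \<sigma> v \<longleftrightarrow> r u v"
  using assms by transfer (auto simp: module_presentation.refl)

lemma of_formal_empty: "of_formal r \<sigma> {#} = 0"
  by transfer (auto simp: module_presentation.refl)

lemma of_formal_plus: "of_formal r \<sigma> (u + v) = of_formal r \<sigma> u + of_formal r \<sigma> v"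
  by transfer (auto simp: module_presentation.refl)

lemma of_formal_pair: "of_formal r \<sigma> {#p, q#} = of_formal r \<sigma> {#p#} + of_formal r \<sigma> {#q#}"
  by (metis add_mset_add_single of_formal_plus union_commute)

lemma of_formal_scale: "universal_scale c (of_formal r \<sigma> u) = of_formal r \<sigma> (\<sigma> c u)"
  by transfer (auto simp: module_presentation.refl module_presentation.scale_empty)

lemma of_formal_sum: "of_formal r \<sigma> u = (\<Sum>p\<in>#u. of_formal r \<sigma> {#p#})"
proof (induction u)
  case (add p u)
  then show ?case
    using of_formal_plus[of r \<sigma> "{#p#}" u] by simp
qed (simp add: of_formal_empty)

section \<open>Multilinear maps and Sweedler sums\<close>

definition scale_pairs where
  "scale_pairs s c u = image_mset (\<lambda>(x, y). (s c x, y)) u"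

definition scale_triples where
  "scale_triples s c u = image_mset (\<lambda>(x, y, z). (s c x, y, z)) u"

text \<open>The pure tensor inside the universal module. Summing \<open>pure2\<close> over a tensor
  recovers that tensor, so this single bilinear map is a complete test for equality.\<close>

definition pure2 where
  "pure2 s x y = of_formal (tensor2_rel s) (scale_pairs s) {#(x, y)#}"

definition pure3 where
  "pure3 s x y z = of_formal (tensor3_rel s) (scale_triples s) {#(x, y, z)#}"

definition Tensor3 where "Tensor3 s = range (class3 s)"

definition k_trilinear where
  "k_trilinear s sB f \<longleftrightarrow> (\<forall>y z. module_hom s sB (\<lambda>x. f x y z)) \<and>
    (\<forall>x z. module_hom s sB (\<lambda>y. f x y z)) \<and> (\<forall>x y. module_hom s sB (\<lambda>z. f x y z))"

lemma module_homI:
  assumes "module s1" "module s2" "\<And>x y. f (x + y) = f x + f y" "\<And>c x. f (s1 c x) = s2 c (f x)"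
  shows "module_hom s1 s2 f"
  using assms by (simp add: module_hom_def module_hom_axioms_def)

section \<open>Tensor powers as coordinates of the universal module\<close>

lemma equivp_tensor2_rel: "equivp (tensor2_rel s)"
  by (intro equivpI reflpI sympI transpI) (fact tensor2_rel.refl tensor2_rel.sym tensor2_rel.trans)+

lemma tensor2_rel_plus:
  "tensor2_rel s u u' \<Longrightarrow> tensor2_rel s v v' \<Longrightarrow> tensor2_rel s (u + v) (u' + v')"
  by (metis add.commute tensor2_rel.plus tensor2_rel.trans)

lemma equivp_tensor3_rel: "equivp (tensor3_rel s)"
  by (intro equivpI reflpI sympI transpI) (fact tensor3_rel.refl tensor3_rel.sym tensor3_rel.trans)+

lemma tensor3_rel_plus:
  "tensor3_rel s u u' \<Longrightarrow> tensor3_rel s v v' \<Longrightarrow> tensor3_rel s (u + v) (u' + v')"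
  by (metis add.commute tensor3_rel.plus tensor3_rel.trans)

lemma module_presentation2:
  assumes "module s"
  shows "module_presentation (tensor2_rel s) (scale_pairs s)"
proof -
  interpret module s by fact
  have scale: "tensor2_rel s (scale_pairs s c u) (scale_pairs s c v)" if "tensor2_rel s u v" for c u v
    using that
  proof induction
    \<comment> \<open>Scaling acts on the first factor, where c now stands outside d; commutativity
      of the scalars exchanges the two.\<close>
    case (balanced d x y)
    show ?case
      using tensor2_rel.balanced[of s d "s c x" y] by (simp add: scale_pairs_def mult.commute)
  next
    case (sym u v)
    show ?case using sym.IH by (rule tensor2_rel.sym)
  next
    case (trans u v w)
    show ?case using trans.IH by (rule tensor2_rel.trans)
  qed (simp_all add: scale_pairs_def scale_right_distrib tensor2_rel.refl tensor2_rel.plus tensor2_rel.zero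
        tensor2_rel.add1 tensor2_rel.add2)
  have distrib: "tensor2_rel s (scale_pairs s (c + d) u) (scale_pairs s c u + scale_pairs s d u)" for c d u
  proof (induction u)
    case (add p u)
    obtain x y where "p = (x, y)" by fastforce
    then show ?case
      using tensor2_rel_plus[OF tensor2_rel.add1[of s "s c x" "s d x" y] add]
      by (simp add: scale_pairs_def scale_left_distrib add_mset_commute)
  qed (simp add: scale_pairs_def tensor2_rel.refl)
  have zero: "tensor2_rel s (scale_pairs s 0 u) {#}" for u
  proof (induction u)
    case (add p u)
    obtain x y where "p = (x, y)" by fastforce
    then show ?case
      using tensor2_rel_plus[OF tensor2_rel.zero[of s y] add] by (simp add: scale_pairs_def)
  qed (simp add: scale_pairs_def tensor2_rel.refl)
  show ?thesis
  proof
    fix c d :: 'a and u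
    show "tensor2_rel s (scale_pairs s c (scale_pairs s d u)) (scale_pairs s (c * d) u)"
      by (simp add: scale_pairs_def case_prod_unfold image_mset.compositionality comp_def tensor2_rel.refl)
    show "tensor2_rel s (scale_pairs s 1 u) u"
      by (simp add: scale_pairs_def case_prod_unfold tensor2_rel.refl)
  next
    fix c :: 'a and u v
    show "tensor2_rel s (scale_pairs s c (u + v)) (scale_pairs s c u + scale_pairs s c v)"
      by (simp add: scale_pairs_def tensor2_rel.refl)
  qed (rule equivp_tensor2_rel scale distrib zero tensor2_rel.plus; assumption)+
qed

lemma module_presentation3:
  assumes "module s"
  shows "module_presentation (tensor3_rel s) (scale_triples s)"
proof -
  interpret module s by fact
  have scale: "tensor3_rel s (scale_triples s c u) (scale_triples s c v)" if "tensor3_rel s u v" for c u v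
    using that
  proof induction
    case (balanced12 d x y z)
    show ?case
      using tensor3_rel.balanced12[of s d "s c x" y z] by (simp add: scale_triples_def mult.commute)
  next
    case (sym u v)
    show ?case using sym.IH by (rule tensor3_rel.sym)
  next
    case (trans u v w)
    show ?case using trans.IH by (rule tensor3_rel.trans)
  qed (simp_all add: scale_triples_def scale_right_distrib tensor3_rel.refl tensor3_rel.plus tensor3_rel.zero
        tensor3_rel.add1 tensor3_rel.add2 tensor3_rel.add3 tensor3_rel.balanced23)
  have distrib: "tensor3_rel s (scale_triples s (c + d) u) (scale_triples s c u + scale_triples s d u)" for c d u
  proof (induction u)
    case (add p u)
    obtain x y z where "p = (x, y, z)" using prod_cases3 by blast
    then show ?case
      using tensor3_rel_plus[OF tensor3_rel.add1[of s "s c x" "s d x" y z] add]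
      by (simp add: scale_triples_def scale_left_distrib add_mset_commute)
  qed (simp add: scale_triples_def tensor3_rel.refl)
  have zero: "tensor3_rel s (scale_triples s 0 u) {#}" for u
  proof (induction u)
    case (add p u)
    obtain x y z where "p = (x, y, z)" using prod_cases3 by blast
    then show ?case
      using tensor3_rel_plus[OF tensor3_rel.zero[of s y z] add] by (simp add: scale_triples_def)
  qed (simp add: scale_triples_def tensor3_rel.refl)
  show ?thesis
  proof
    fix c d :: 'a and u
    show "tensor3_rel s (scale_triples s c (scale_triples s d u)) (scale_triples s (c * d) u)"
      by (simp add: scale_triples_def case_prod_unfold image_mset.compositionality comp_def tensor3_rel.refl)
    show "tensor3_rel s (scale_triples s 1 u) u"
      by (simp add: scale_triples_def case_prod_unfold tensor3_rel.refl)
  next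
    fix c :: 'a and u v
    show "tensor3_rel s (scale_triples s c (u + v)) (scale_triples s c u + scale_triples s c v)"
      by (simp add: scale_triples_def tensor3_rel.refl)
  qed (rule equivp_tensor3_rel scale distrib zero tensor3_rel.plus; assumption)+
qed

lemma pure2_bilinear:
  assumes "module s"
  shows "k_bilinear s s universal_scale (pure2 s)"
proof -
  note p = module_presentation2[OF assms]
  note eq = of_formal_eq_iff[OF p]
  have a: "pure2 s (x + x') y = pure2 s x y + pure2 s x' y" for x x' y
    using tensor2_rel.add1[of s x x' y] by (simp add: pure2_def flip: eq of_formal_pair)
  have b: "pure2 s x (y + y') = pure2 s x y + pure2 s x y'" for x y y'
    using tensor2_rel.add2[of s x y y'] by (simp add: pure2_def flip: eq of_formal_pair)
  have c: "pure2 s (s k x) y = universal_scale k (pure2 s x y)" for k x y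
    by (simp add: pure2_def of_formal_scale) (simp add: scale_pairs_def)
  have d: "pure2 s x (s k y) = universal_scale k (pure2 s x y)" for k x y
    unfolding c[symmetric] using tensor2_rel.balanced[of s k x y] by (simp add: pure2_def flip: eq)
  show ?thesis
    unfolding k_bilinear_def by (auto intro!: module_homI assms simp: a b c d)
qed

lemma pure3_trilinear:
  assumes "module s"
  shows "k_trilinear s universal_scale (pure3 s)"
proof -
  note p = module_presentation3[OF assms]
  note eq = of_formal_eq_iff[OF p]
  have a: "pure3 s (x + x') y z = pure3 s x y z + pure3 s x' y z" for x x' y z
    using tensor3_rel.add1[of s x x' y z] by (simp add: pure3_def flip: eq of_formal_pair)
  have b: "pure3 s x (y + y') z = pure3 s x y z + pure3 s x y' z" for x y y' z
    using tensor3_rel.add2[of s x y y' z] by (simp add: pure3_def flip: eq of_formal_pair)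
  have c: "pure3 s x y (z + z') = pure3 s x y z + pure3 s x y z'" for x y z z'
    using tensor3_rel.add3[of s x y z z'] by (simp add: pure3_def flip: eq of_formal_pair)
  have d: "pure3 s (s k x) y z = universal_scale k (pure3 s x y z)" for k x y z
    by (simp add: pure3_def of_formal_scale) (simp add: scale_triples_def)
  have e: "pure3 s x (s k y) z = universal_scale k (pure3 s x y z)" for k x y z
    unfolding d[symmetric] using tensor3_rel.balanced12[of s k x y z] by (simp add: pure3_def flip: eq)
  have f: "pure3 s x y (s k z) = universal_scale k (pure3 s x y z)" for k x y z
    unfolding e[symmetric] using tensor3_rel.balanced23[of s x k y z] by (simp add: pure3_def flip: eq)
  show ?thesis
    unfolding k_trilinear_def by (auto intro!: module_homI assms simp: a b c d e f)
qed

lemma sweedler_class2_bilinear: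
  assumes "k_bilinear s s sB f"
  shows "sweedler (class2 s u) f = (\<Sum>(x, y)\<in>#u. f x y)"
  using assms by (intro sweedler_class2) (auto simp: k_bilinear_def module_hom_def module_hom_axioms_def)

lemma sweedler3_class3_trilinear:
  assumes "k_trilinear s sB f"
  shows "sweedler3 (class3 s u) f = (\<Sum>(x, y, z)\<in>#u. f x y z)"
  using assms by (intro sweedler3_class3) (auto simp: k_trilinear_def module_hom_def module_hom_axioms_def)

lemma class2_in [simp]: "class2 s u \<in> Tensor2 s"
  by (simp add: Tensor2_def)

lemma class3_in [simp]: "class3 s u \<in> Tensor3 s"
  by (simp add: Tensor3_def)

text \<open>The sum of \<open>pure2\<close> over a class is the embedding of any representative, and
  the embedding separates classes. Tensor equations thereby become equations of Sweedler sums,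
  accessible to rewriting.\<close>

lemma tensor2_eqI:
  assumes s: "module s" and t: "t \<in> Tensor2 s" "t' \<in> Tensor2 s"
    and eq: "sweedler t (pure2 s) = sweedler t' (pure2 s)"
  shows "t = t'"
proof -
  obtain u v where u: "t = class2 s u" and v: "t' = class2 s v"
    using t by (auto simp: Tensor2_def)
  have "of_formal (tensor2_rel s) (scale_pairs s) w = sweedler (class2 s w) (pure2 s)" for w
    by (subst of_formal_sum)
      (simp add: sweedler_class2_bilinear[OF pure2_bilinear[OF s]] pure2_def case_prod_unfold)
  then have "tensor2_rel s u v"
    using eq u v of_formal_eq_iff[OF module_presentation2[OF s]] by metis
  then show ?thesis
    using equivp_tensor2_rel[of s] by (simp add: u v class2_def equivp_def)
qed

lemma tensor3_eqI:
  assumes s: "module s" and t: "t \<in> Tensor3 s" "t' \<in> Tensor3 s"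
    and eq: "sweedler3 t (pure3 s) = sweedler3 t' (pure3 s)"
  shows "t = t'"
proof -
  obtain u v where u: "t = class3 s u" and v: "t' = class3 s v"
    using t by (auto simp: Tensor3_def)
  have "of_formal (tensor3_rel s) (scale_triples s) w = sweedler3 (class3 s w) (pure3 s)" for w
    by (subst of_formal_sum)
      (simp add: sweedler3_class3_trilinear[OF pure3_trilinear[OF s]] pure3_def case_prod_unfold)
  then have "tensor3_rel s u v"
    using eq u v of_formal_eq_iff[OF module_presentation3[OF s]] by metis
  then show ?thesis
    using equivp_tensor3_rel[of s] by (simp add: u v class3_def equivp_def)
qed

section \<open>Sweedler sums as finite sums, and their linearity\<close>

lemma sum_mset_sum_mset:
  "(\<Sum>p\<in>#(\<Sum>q\<in>#w. g q). h p) = (\<Sum>q\<in>#w. \<Sum>p\<in>#g q. h p)"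
  by (induction w) simp_all

lemma sum_mset_sweedler:
  "(\<Sum>p\<in>#sweedler t g. h p) = sweedler t (\<lambda>x y. \<Sum>p\<in>#g x y. h p)"
  by (simp add: sweedler_def sum_mset_sum_mset case_prod_unfold)

lemma sum_mset_sweedler3:
  "(\<Sum>p\<in>#sweedler3 t g. h p) = sweedler3 t (\<lambda>x y z. \<Sum>p\<in>#g x y z. h p)"
  by (simp add: sweedler3_def sum_mset_sum_mset case_prod_unfold)

text \<open>No linearity is required: each tensor is represented by one chosen multiset, and finite
  sums commute.\<close>

lemma sweedler_swap:
  "sweedler t (\<lambda>x y. sweedler t' (\<lambda>u v. f x y u v)) =
    sweedler t' (\<lambda>u v. sweedler t (\<lambda>x y. f x y u v))"
  unfolding sweedler_def case_prod_unfold
  by (rule sum_mset.swap)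

lemma sweedler_add:
  "sweedler t (\<lambda>x y. f x y + g x y) = sweedler t f + sweedler t g"
  by (simp add: sweedler_def case_prod_unfold sum_mset.distrib)

lemma module_hom_sum_mset:
  assumes "module_hom s1 s2 \<phi>"
  shows "\<phi> (\<Sum>p\<in>#u. g p) = (\<Sum>p\<in>#u. \<phi> (g p))"
proof -
  interpret module_hom s1 s2 \<phi> by fact
  show ?thesis
    by (induction u) (simp_all add: add)
qed

lemma module_hom_sweedler:
  assumes "module_hom s1 s2 \<phi>"
  shows "\<phi> (sweedler t f) = sweedler t (\<lambda>x y. \<phi> (f x y))"
  unfolding sweedler_def by (simp add: module_hom_sum_mset[OF assms] case_prod_unfold)

lemma module_hom_sum_msetI:
  assumes "\<And>p. module_hom s1 s2 (f p)"
  shows "module_hom s1 s2 (\<lambda>x. \<Sum>p\<in>#u. f p x)"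
proof -
  have m: "module s1" "module s2"
    using assms by (simp_all add: module_hom_def)
  interpret m2: module s2 by fact
  show ?thesis
  proof (induction u)
    case empty
    then show ?case using m by (auto intro!: module_homI)
  next
    case (add p u)
    interpret p: module_hom s1 s2 "f p" by (rule assms)
    interpret u: module_hom s1 s2 "\<lambda>x. \<Sum>p\<in>#u. f p x" by (rule add)
    show ?case
      using m by (auto intro!: module_homI simp: p.add u.add p.scale u.scale m2.scale_right_distrib)
  qed
qed

text \<open>
  Used as conditional rewrite rules, these facts establish multilinearity of nested Sweedler sums
  and thus the side conditions of the evaluation lemmas below. There the scalar multiplication
  \<open>sB\<close> of the target occurs only in the premise, so rewriting needs an explicit instance of it.
\<close>

named_theorems linear_intros

lemma module_hom_sweedlerI [linear_intros]:
  assumes "\<And>u v. module_hom s1 s2 (\<lambda>x. f x u v)"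
  shows "module_hom s1 s2 (\<lambda>x. sweedler t (\<lambda>u v. f x u v))"
  unfolding sweedler_def case_prod_unfold by (rule module_hom_sum_msetI) (rule assms)

lemma module_hom_sweedler3I [linear_intros]:
  assumes "\<And>u v w. module_hom s1 s2 (\<lambda>x. f x u v w)"
  shows "module_hom s1 s2 (\<lambda>x. sweedler3 t (\<lambda>u v w. f x u v w))"
  unfolding sweedler3_def case_prod_unfold by (rule module_hom_sum_msetI) (rule assms)

lemma module_hom_compose:
  assumes "module_hom s2 s3 g" "module_hom s1 s2 f"
  shows "module_hom s1 s3 (\<lambda>x. g (f x))"
  using assms by (simp add: module_hom_def module_hom_axioms_def)

lemma module_hom_id [linear_intros]: "module s \<Longrightarrow> module_hom s s (\<lambda>x. x)"
  by (rule module_homI) simp_all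

lemma k_bilinearI [linear_intros]:
  "(\<And>y. module_hom s1 s3 (\<lambda>x. f x y)) \<Longrightarrow> (\<And>x. module_hom s2 s3 (\<lambda>y. f x y)) \<Longrightarrow> k_bilinear s1 s2 s3 f"
  by (simp add: k_bilinear_def)

lemma k_trilinearI [linear_intros]:
  "(\<And>y z. module_hom s sB (\<lambda>x. f x y z)) \<Longrightarrow> (\<And>x z. module_hom s sB (\<lambda>y. f x y z)) \<Longrightarrow>
    (\<And>x y. module_hom s sB (\<lambda>z. f x y z)) \<Longrightarrow> k_trilinear s sB f"
  by (simp add: k_trilinear_def)

lemma bilinear_left: "k_bilinear s1 s2 s3 f \<Longrightarrow> module_hom s s1 g \<Longrightarrow> module_hom s s3 (\<lambda>x. f (g x) y)"
  by (rule module_hom_compose[of s1 s3 "\<lambda>x. f x y"]) (simp_all add: k_bilinear_def)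

lemma bilinear_right: "k_bilinear s1 s2 s3 f \<Longrightarrow> module_hom s s2 g \<Longrightarrow> module_hom s s3 (\<lambda>x. f y (g x))"
  by (rule module_hom_compose[of s2 s3 "f y"]) (simp_all add: k_bilinear_def)

lemma bilinear_sweedler_left:
  "k_bilinear s1 s2 s3 f \<Longrightarrow> f (sweedler t g) y = sweedler t (\<lambda>u v. f (g u v) y)"
  by (rule module_hom_sweedler[of s1 s3 "\<lambda>x. f x y"]) (simp add: k_bilinear_def)

lemma bilinear_sweedler_right:
  "k_bilinear s1 s2 s3 f \<Longrightarrow> f x (sweedler t g) = sweedler t (\<lambda>u v. f x (g u v))"
  by (rule module_hom_sweedler[of s2 s3 "f x"]) (simp add: k_bilinear_def)

lemma trilinear_arg1:
  "k_trilinear s sB f \<Longrightarrow> module_hom s' s g \<Longrightarrow> module_hom s' sB (\<lambda>x. f (g x) y z)"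
  by (rule module_hom_compose[of s sB "\<lambda>x. f x y z"]) (simp_all add: k_trilinear_def)

lemma trilinear_arg2:
  "k_trilinear s sB f \<Longrightarrow> module_hom s' s g \<Longrightarrow> module_hom s' sB (\<lambda>x. f y (g x) z)"
  by (rule module_hom_compose[of s sB "\<lambda>x. f y x z"]) (simp_all add: k_trilinear_def)

lemma trilinear_arg3:
  "k_trilinear s sB f \<Longrightarrow> module_hom s' s g \<Longrightarrow> module_hom s' sB (\<lambda>x. f y z (g x))"
  by (rule module_hom_compose[of s sB "\<lambda>x. f y z x"]) (simp_all add: k_trilinear_def)

section \<open>Evaluation of multilinear maps at products, flips and legs\<close>

lemma sweedler_mult2:
  assumes "k_bilinear s s sB f"
  shows "sweedler (mult2 s t t') f = sweedler t (\<lambda>a b. sweedler t' (\<lambda>c d. f (a * c) (b * d)))"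
  by (simp add: mult2_def sweedler_class2_bilinear[OF assms] sum_mset_sweedler)

lemma sweedler_one2: "k_bilinear s s sB f \<Longrightarrow> sweedler (one2 s) f = f 1 1"
  by (simp add: one2_def sweedler_class2_bilinear)

lemma sweedler_flip:
  assumes "k_bilinear s s sB f"
  shows "sweedler (flip s t) f = sweedler t (\<lambda>x y. f y x)"
  by (simp add: flip_def sweedler_class2_bilinear[OF assms] sum_mset_sweedler)

lemma sweedler_tensor2_add:
  assumes "k_bilinear s s sB f"
  shows "sweedler (tensor2_add s t t') f = sweedler t f + sweedler t' f"
  by (simp add: tensor2_add_def sweedler_class2_bilinear[OF assms] sum_mset_sweedler)

lemma sweedler_tensor2_scale:
  assumes "k_bilinear s s sB f"
  shows "sweedler (tensor2_scale s c t) f = sB c (sweedler t f)"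
proof -
  have "module_hom sB sB (sB c)"
    using assms by (auto simp: k_bilinear_def module_hom_def module_hom_axioms_def
      module.scale_right_distrib module.scale_scale mult.commute)
  moreover have "f (s c x) y = sB c (f x y)" for x y
    using assms by (auto simp: k_bilinear_def module_hom_def module_hom_axioms_def)
  ultimately show ?thesis
    by (simp add: tensor2_scale_def sweedler_class2_bilinear[OF assms] sum_mset_sweedler
      module_hom_sweedler[of sB sB "sB c"])
qed

lemma sweedler3_mult3:
  assumes "k_trilinear s sB f"
  shows "sweedler3 (mult3 s t t') f =
    sweedler3 t (\<lambda>a b c. sweedler3 t' (\<lambda>a' b' c'. f (a * a') (b * b') (c * c')))"
  by (simp add: mult3_def sweedler3_class3_trilinear[OF assms] sum_mset_sweedler3)

definition one3 :: "('k::comm_ring_1 \<Rightarrow> 'h::ring_1 \<Rightarrow> 'h) \<Rightarrow> ('h \<times> 'h \<times> 'h) multiset set" where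
  "one3 s = class3 s {#(1, 1, 1)#}"

lemma sweedler3_one3: "k_trilinear s sB f \<Longrightarrow> sweedler3 (one3 s) f = f 1 1 1"
  by (simp add: one3_def sweedler3_class3_trilinear)

lemma sweedler3_leg12: "k_trilinear s sB f \<Longrightarrow> sweedler3 (leg12 s t) f = sweedler t (\<lambda>x y. f x y 1)"
  by (simp add: leg12_def sweedler3_class3_trilinear sum_mset_sweedler)

lemma sweedler3_leg13: "k_trilinear s sB f \<Longrightarrow> sweedler3 (leg13 s t) f = sweedler t (\<lambda>x y. f x 1 y)"
  by (simp add: leg13_def sweedler3_class3_trilinear sum_mset_sweedler)

lemma sweedler3_leg23: "k_trilinear s sB f \<Longrightarrow> sweedler3 (leg23 s t) f = sweedler t (\<lambda>x y. f 1 x y)"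
  by (simp add: leg23_def sweedler3_class3_trilinear sum_mset_sweedler)

text \<open>The leg transpositions carry the cocycle condition to the permuted forms on which the
  hexagon identities of the twisted R rest.\<close>

definition swap12 where
  "swap12 s t = class3 s (sweedler3 t (\<lambda>x y z. {#(y, x, z)#}))"

definition swap23 where
  "swap23 s t = class3 s (sweedler3 t (\<lambda>x y z. {#(x, z, y)#}))"

lemma sweedler3_swap12:
  "k_trilinear s sB f \<Longrightarrow> sweedler3 (swap12 s t) f = sweedler3 t (\<lambda>x y z. f y x z)"
  by (simp add: swap12_def sweedler3_class3_trilinear sum_mset_sweedler3)

lemma sweedler3_swap23:
  "k_trilinear s sB f \<Longrightarrow> sweedler3 (swap23 s t) f = sweedler3 t (\<lambda>x y z. f x z y)"
  by (simp add: swap23_def sweedler3_class3_trilinear sum_mset_sweedler3)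

lemma sweedler3_comult_id:
  "k_trilinear (hscale H) sB f \<Longrightarrow>
    sweedler3 (comult_id H t) f = sweedler t (\<lambda>x y. sweedler (comult H x) (\<lambda>u v. f u v y))"
  by (simp add: comult_id_def sweedler3_class3_trilinear sum_mset_sweedler)

lemma sweedler3_id_comult:
  "k_trilinear (hscale H) sB f \<Longrightarrow>
    sweedler3 (id_comult H t) f = sweedler t (\<lambda>x y. sweedler (comult H y) (\<lambda>u v. f x u v))"
  by (simp add: id_comult_def sweedler3_class3_trilinear sum_mset_sweedler)

lemma mult2_in [simp]: "mult2 s t t' \<in> Tensor2 s"
  by (simp add: mult2_def)

lemma one2_in [simp]: "one2 s \<in> Tensor2 s"
  by (simp add: one2_def)

lemma flip_in [simp]: "flip s t \<in> Tensor2 s"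
  by (simp add: flip_def)

lemma tensor2_add_in [simp]: "tensor2_add s t t' \<in> Tensor2 s"
  by (simp add: tensor2_add_def)

lemma tensor2_scale_in [simp]: "tensor2_scale s c t \<in> Tensor2 s"
  by (simp add: tensor2_scale_def)

lemma mult3_in [simp]: "mult3 s t t' \<in> Tensor3 s"
  by (simp add: mult3_def)

lemma one3_in [simp]: "one3 s \<in> Tensor3 s"
  by (simp add: one3_def)

lemma legs_in [simp]: "leg12 s t \<in> Tensor3 s" "leg13 s t \<in> Tensor3 s" "leg23 s t \<in> Tensor3 s"
  by (simp_all add: leg12_def leg13_def leg23_def)

lemma swaps_in [simp]: "swap12 s t \<in> Tensor3 s" "swap23 s t \<in> Tensor3 s"
  by (simp_all add: swap12_def swap23_def)

lemma comult_id_in [simp]: "comult_id H t \<in> Tensor3 (hscale H)"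
  by (simp add: comult_id_def)

lemma id_comult_in [simp]: "id_comult H t \<in> Tensor3 (hscale H)"
  by (simp add: id_comult_def)

section \<open>Tensor powers of an algebra\<close>

text \<open>Separated from the coproduct because H and its twist have the same underlying algebra
  and hence the same tensor algebras.\<close>

locale k_algebra =
  fixes s :: "'k::comm_ring_1 \<Rightarrow> 'h::ring_1 \<Rightarrow> 'h"
  assumes bilinear: "k_bilinear s s s (*)"
begin

lemma module_scale [linear_intros]: "module s"
  using bilinear by (auto simp: k_bilinear_def module_hom_def)

lemmas linear_mult [linear_intros] = bilinear_left[OF bilinear] bilinear_right[OF bilinear]

lemmas linear_pure2 [linear_intros] =
  bilinear_left[OF pure2_bilinear[OF module_scale]] bilinear_right[OF pure2_bilinear[OF module_scale]]

lemmas linear_pure3 [linear_intros] = trilinear_arg1[OF pure3_trilinear[OF module_scale]]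
  trilinear_arg2[OF pure3_trilinear[OF module_scale]]
  trilinear_arg3[OF pure3_trilinear[OF module_scale]]

lemmas mult_sweedler = bilinear_sweedler_left[OF bilinear] bilinear_sweedler_right[OF bilinear]

abbreviation prod2 (infixl \<open>\<bullet>\<close> 70) where "prod2 \<equiv> mult2 s"
abbreviation prod3 (infixl \<open>\<odot>\<close> 70) where "prod3 \<equiv> mult3 s"

lemmas eval2 = sweedler_mult2[where sB = universal_scale] sweedler_one2[where sB = universal_scale]
  sweedler_flip[where sB = universal_scale] sweedler_tensor2_add[where sB = universal_scale]
  sweedler_tensor2_scale[where sB = universal_scale]

lemmas eval3 = sweedler3_mult3[where sB = universal_scale] sweedler3_one3[where sB = universal_scale]
  sweedler3_leg12[where sB = universal_scale] sweedler3_leg13[where sB = universal_scale]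
  sweedler3_leg23[where sB = universal_scale] sweedler3_swap12[where sB = universal_scale]
  sweedler3_swap23[where sB = universal_scale] sweedler3_comult_id[where sB = universal_scale]
  sweedler3_id_comult[where sB = universal_scale]

lemma mult2_assoc: "t \<bullet> t' \<bullet> t'' = t \<bullet> (t' \<bullet> t'')"
  by (rule tensor2_eqI[OF module_scale]) (simp_all add: eval2 linear_intros mult.assoc)

lemma mult2_one [simp]:
  assumes "t \<in> Tensor2 s"
  shows "t \<bullet> one2 s = t" "one2 s \<bullet> t = t"
  by (rule tensor2_eqI[OF module_scale]; simp add: eval2 linear_intros assms)+

lemma flip_mult2: "flip s (t \<bullet> t') = flip s t \<bullet> flip s t'"
  by (rule tensor2_eqI[OF module_scale]) (simp_all add: eval2 linear_intros)

lemma flip_one2 [simp]: "flip s (one2 s) = one2 s"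
  by (rule tensor2_eqI[OF module_scale]) (simp_all add: eval2 linear_intros)

lemma flip_flip [simp]: "t \<in> Tensor2 s \<Longrightarrow> flip s (flip s t) = t"
  by (rule tensor2_eqI[OF module_scale]) (simp_all add: eval2 linear_intros)

lemma mult3_assoc: "t \<odot> t' \<odot> t'' = t \<odot> (t' \<odot> t'')"
  by (rule tensor3_eqI[OF module_scale]) (simp_all add: eval3 linear_intros mult.assoc)

lemma mult3_one [simp]:
  assumes "t \<in> Tensor3 s"
  shows "t \<odot> one3 s = t" "one3 s \<odot> t = t"
  by (rule tensor3_eqI[OF module_scale]; simp add: eval3 linear_intros assms)+

lemma leg12_mult2: "leg12 s (t \<bullet> t') = leg12 s t \<odot> leg12 s t'"
  by (rule tensor3_eqI[OF module_scale]) (simp_all add: eval2 eval3 linear_intros)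

lemma leg13_mult2: "leg13 s (t \<bullet> t') = leg13 s t \<odot> leg13 s t'"
  by (rule tensor3_eqI[OF module_scale]) (simp_all add: eval2 eval3 linear_intros)

lemma leg23_mult2: "leg23 s (t \<bullet> t') = leg23 s t \<odot> leg23 s t'"
  by (rule tensor3_eqI[OF module_scale]) (simp_all add: eval2 eval3 linear_intros)

lemma leg_one2: "leg12 s (one2 s) = one3 s" "leg13 s (one2 s) = one3 s" "leg23 s (one2 s) = one3 s"
  by (rule tensor3_eqI[OF module_scale]; simp add: eval2 eval3 linear_intros)+

lemma legs_mult_eq_one:
  assumes "a \<bullet> b = one2 s"
  shows "leg12 s a \<odot> leg12 s b = one3 s"
    "leg13 s a \<odot> leg13 s b = one3 s"
    "leg23 s a \<odot> leg23 s b = one3 s"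
  by (simp_all add: leg_one2 assms flip: leg12_mult2 leg13_mult2 leg23_mult2)

lemma swap12_mult3: "swap12 s (t \<odot> t') = swap12 s t \<odot> swap12 s t'"
  by (rule tensor3_eqI[OF module_scale]) (simp_all add: eval3 linear_intros)

lemma swap23_mult3: "swap23 s (t \<odot> t') = swap23 s t \<odot> swap23 s t'"
  by (rule tensor3_eqI[OF module_scale]) (simp_all add: eval3 linear_intros)

lemma swap12_legs:
  "swap12 s (leg12 s t) = leg12 s (flip s t)"
  "swap12 s (leg13 s t) = leg23 s t"
  "swap12 s (leg23 s t) = leg13 s t"
  by (rule tensor3_eqI[OF module_scale]; simp add: eval2 eval3 linear_intros)+

lemma swap23_legs:
  "swap23 s (leg12 s t) = leg13 s t"
  "swap23 s (leg13 s t) = leg12 s t"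
  "swap23 s (leg23 s t) = leg23 s (flip s t)"
  by (rule tensor3_eqI[OF module_scale]; simp add: eval2 eval3 linear_intros)+

lemma inverse2_unique: "is_inverse2 s t a \<Longrightarrow> is_inverse2 s t b \<Longrightarrow> a = b"
  unfolding is_inverse2_def by (metis mult2_assoc mult2_one)

lemma inv2_eqI: "is_inverse2 s t t' \<Longrightarrow> inv2 s t = t'"
  unfolding inv2_def by (rule the_equality) (simp_all add: inverse2_unique)

lemma mult2_cancel: "a \<bullet> b = one2 s \<Longrightarrow> t \<in> Tensor2 s \<Longrightarrow> a \<bullet> (b \<bullet> t) = t"
  by (simp flip: mult2_assoc)

lemma mult3_cancel: "a \<odot> b = one3 s \<Longrightarrow> t \<in> Tensor3 s \<Longrightarrow> a \<odot> (b \<odot> t) = t"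
  by (simp flip: mult3_assoc)

lemma inverse2_inv2: "invertible2 s t \<Longrightarrow> is_inverse2 s t (inv2 s t)"
  by (metis inv2_eqI invertible2_def)

end

lemma linear_add [linear_intros]:
  assumes f: "module_hom s1 s2 f" and g: "module_hom s1 s2 g"
  shows "module_hom s1 s2 (\<lambda>x. f x + g x)"
proof -
  interpret f: module_hom s1 s2 f by fact
  interpret g: module_hom s1 s2 g by fact
  show ?thesis
    by (intro module_homI) (simp_all add: f.m1.module_axioms f.m2.module_axioms f.add g.add f.scale g.scale
      f.m2.scale_right_distrib)
qed

lemma linear_diff [linear_intros]:
  assumes f: "module_hom s1 s2 f" and g: "module_hom s1 s2 g"
  shows "module_hom s1 s2 (\<lambda>x. f x - g x)"
proof -
  interpret f: module_hom s1 s2 f by fact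
  interpret g: module_hom s1 s2 g by fact
  show ?thesis
    by (intro module_homI) (simp_all add: f.m1.module_axioms f.m2.module_axioms f.add g.add f.scale g.scale
      f.m2.scale_right_diff_distrib)
qed

lemma sweedler_zero [simp]: "sweedler t (\<lambda>x y. 0) = 0"
  by (simp add: sweedler_def case_prod_unfold)

lemma sweedler_diff:
  fixes f g :: "_ \<Rightarrow> _ \<Rightarrow> 'b::ab_group_add"
  shows "sweedler t (\<lambda>x y. f x y - g x y) = sweedler t f - sweedler t g"
  using sweedler_add[of t "\<lambda>x y. f x y - g x y" g] by simp

section \<open>Hopf algebras\<close>

sublocale hopf_algebra \<subseteq> k_algebra "hscale H"
  by (rule k_algebra.intro) (rule mult_bilinear)

context hopf_algebra
begin

notation prod2 (infixl \<open>\<bullet>\<close> 70)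
notation prod3 (infixl \<open>\<odot>\<close> 70)

declare comult_in [simp]

lemma linear_comult [linear_intros]:
  assumes g: "module_hom s' (hscale H) g" and f: "k_bilinear (hscale H) (hscale H) sB f"
  shows "module_hom s' sB (\<lambda>x. sweedler (comult H (g x)) f)"
proof (rule module_hom_compose[OF _ g])
  show "module_hom (hscale H) sB (\<lambda>x. sweedler (comult H x) f)"
    using f by (intro module_homI)
      (auto simp: comult_add comult_scale sweedler_tensor2_add[OF f] sweedler_tensor2_scale[OF f]
        k_bilinear_def module_hom_def)
qed

lemma linear_antipode [linear_intros]:
  "module_hom s' (hscale H) g \<Longrightarrow> module_hom s' (hscale H) (\<lambda>x. antipode H (g x))"
  by (rule module_hom_compose[OF antipode_linear])

lemma linear_counit_scale:
  assumes "module_hom s' (hscale H) g" "module sB"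
  shows "module_hom s' sB (\<lambda>x. sB (counit H (g x)) y)"
proof (rule module_hom_compose[OF _ assms(1)])
  interpret module_hom "hscale H" "(*)" "counit H" by (rule counit_linear)
  interpret B: module sB by fact
  show "module_hom (hscale H) sB (\<lambda>x. sB (counit H x) y)"
    using assms by (intro module_homI) (simp_all add: add scale B.scale_left_distrib linear_intros)
qed

lemma linear_scale:
  assumes "module_hom s' sB g" 
  shows "module_hom s' sB (\<lambda>x. sB c (g x))"
proof (rule module_hom_compose[OF _ assms])
  interpret B: module sB using assms by (simp add: module_hom_def)
  show "module_hom sB sB (\<lambda>x. sB c x)"
    by (intro module_homI) (simp_all add: B.module_axioms B.scale_right_distrib mult.commute)
qed

lemmas [linear_intros] =
  linear_counit_scale[where sB = "hscale H"] linear_scale[where sB = "hscale H"]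
  linear_counit_scale[where sB = universal_scale] linear_scale[where sB = universal_scale]

lemma scale_mult [simp]:
  "hscale H c x * y = hscale H c (x * y)" "x * hscale H c y = hscale H c (x * y)"
  using bilinear by (auto simp: k_bilinear_def module_hom_def module_hom_axioms_def)

lemma scale_scale [simp]: "hscale H c (hscale H d x) = hscale H (c * d) x"
  using module.scale_scale[OF module_scale] by blast

lemma scale_one [simp]: "hscale H 1 x = x"
  using module.scale_one[OF module_scale] by blast

lemma scale_sweedler: "hscale H c (sweedler t f) = sweedler t (\<lambda>u v. hscale H c (f u v))"
  by (rule module_hom_sweedler[of "hscale H" "hscale H" "hscale H c"]) (simp add: linear_intros)

lemma coassoc_sweedler:
  assumes f: "k_trilinear (hscale H) sB f"
  shows "sweedler (comult H x) (\<lambda>u v. sweedler (comult H u) (\<lambda>p q. f p q v)) =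
    sweedler (comult H x) (\<lambda>u v. sweedler (comult H v) (\<lambda>p q. f u p q))"
  using arg_cong[OF coassoc, of "\<lambda>t. sweedler3 t f"]
  by (simp add: sweedler3_comult_id[OF f] sweedler3_id_comult[OF f])

lemma comult_mult_sweedler:
  assumes "k_bilinear (hscale H) (hscale H) sB f"
  shows "sweedler (comult H (x * y)) f =
    sweedler (comult H x) (\<lambda>a b. sweedler (comult H y) (\<lambda>c d. f (a * c) (b * d)))"
  by (simp add: comult_mult sweedler_mult2[OF assms])

lemma counit_left_sweedler:
  assumes "module_hom (hscale H) sB f"
  shows "sweedler (comult H x) (\<lambda>u v. sB (counit H u) (f v)) = f x"
proof -
  interpret module_hom "hscale H" sB f by fact
  show ?thesis
    using module_hom_sweedler[OF assms, of "comult H x" "\<lambda>u v. hscale H (counit H u) v"]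
    by (simp add: counit_left scale)
qed

lemma counit_right_sweedler:
  assumes "module_hom (hscale H) sB f"
  shows "sweedler (comult H x) (\<lambda>u v. sB (counit H v) (f u)) = f x"
proof -
  interpret module_hom "hscale H" sB f by fact
  show ?thesis
    using module_hom_sweedler[OF assms, of "comult H x" "\<lambda>u v. hscale H (counit H v) u"]
    by (simp add: counit_right scale)
qed

lemma antipode_left_sweedler:
  assumes "module_hom (hscale H) sB f"
  shows "sweedler (comult H x) (\<lambda>u v. f (antipode H u * v)) = sB (counit H x) (f 1)"
proof -
  interpret module_hom "hscale H" sB f by fact
  show ?thesis
    using module_hom_sweedler[OF assms, of "comult H x" "\<lambda>u v. antipode H u * v"]
    by (simp add: antipode_left scale)
qed

lemma antipode_right_sweedler:
  assumes "module_hom (hscale H) sB f"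
  shows "sweedler (comult H x) (\<lambda>u v. f (u * antipode H v)) = sB (counit H x) (f 1)"
proof -
  interpret module_hom "hscale H" sB f by fact
  show ?thesis
    using module_hom_sweedler[OF assms, of "comult H x" "\<lambda>u v. u * antipode H v"]
    by (simp add: antipode_right scale)
qed

lemma comult_id_mult2: "comult_id H (t \<bullet> t') = comult_id H t \<odot> comult_id H t'"
  by (rule tensor3_eqI[OF module_scale])
    (simp_all add: eval2 eval3 comult_mult linear_intros sweedler_swap[of "comult H _" t'])

lemma id_comult_mult2: "id_comult H (t \<bullet> t') = id_comult H t \<odot> id_comult H t'"
  by (rule tensor3_eqI[OF module_scale])
    (simp_all add: eval2 eval3 comult_mult linear_intros sweedler_swap[of "comult H _" t'])

lemma comult_id_one2: "comult_id H (one2 (hscale H)) = one3 (hscale H)"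
  by (rule tensor3_eqI[OF module_scale])
    (simp_all add: eval2 eval3 comult_one linear_intros)

lemma id_comult_one2: "id_comult H (one2 (hscale H)) = one3 (hscale H)"
  by (rule tensor3_eqI[OF module_scale])
    (simp_all add: eval2 eval3 comult_one linear_intros)

lemma comult_id_flip: "comult_id H (flip (hscale H) t) =
    swap23 (hscale H) (swap12 (hscale H) (id_comult H t))"
  by (rule tensor3_eqI[OF module_scale])
    (simp_all add: eval2 eval3 linear_intros)

lemma id_comult_flip: "id_comult H (flip (hscale H) t) =
    swap12 (hscale H) (swap23 (hscale H) (comult_id H t))"
  by (rule tensor3_eqI[OF module_scale])
    (simp_all add: eval2 eval3 linear_intros)

end

section \<open>Modules over a Hopf algebra and cancellation of an action\<close>

locale hopf_module = hopf_algebra H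
  for H :: "('k::comm_ring_1, 'h::ring_1) hopf_data" +
  fixes sN :: "'k \<Rightarrow> 'n::ab_group_add \<Rightarrow> 'n" and act :: "'h \<Rightarrow> 'n \<Rightarrow> 'n"
  assumes left_module: "left_module H sN act"
begin

lemma act_bilinear: "k_bilinear (hscale H) sN sN act"
  and act_one [simp]: "act 1 n = n"
  and act_mult: "act (x * y) n = act x (act y n)"
  using left_module by (simp_all add: left_module_def)

lemma module_sN [linear_intros]: "module sN"
  using act_bilinear by (simp add: k_bilinear_def module_hom_def)

lemmas [linear_intros] = linear_counit_scale[where sB = sN] linear_scale[where sB = sN]
lemmas linear_act [linear_intros] = bilinear_left[OF act_bilinear] bilinear_right[OF act_bilinear]
lemmas act_sweedler = bilinear_sweedler_left[OF act_bilinear] bilinear_sweedler_right[OF act_bilinear]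

lemma act_scale [simp]: "act (hscale H c x) n = sN c (act x n)" "act x (sN c n) = sN c (act x n)"
  using act_bilinear by (auto simp: k_bilinear_def module_hom_def module_hom_axioms_def)

lemma act_add: "act x (m + n) = act x m + act x n"
  using act_bilinear by (auto simp: k_bilinear_def module_hom_def module_hom_axioms_def)

lemma scalar_sweedler: "sN c (sweedler t f) = sweedler t (\<lambda>u v. sN c (f u v))"
  by (rule module_hom_sweedler[of sN sN "sN c"]) (simp add: linear_intros)

text \<open>The map x \<otimes> n \<mapsto> x1 \<otimes> x2 n has the inverse x \<otimes> n
  \<mapsto> x1 \<otimes> S(x2) n, so a bilinear map that vanishes on its image is zero. This removes
  an action from an identity that is known only after acting through a coproduct.\<close>

lemma bilinear_cancel:
  assumes g: "k_bilinear (hscale H) sN sB g"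
    and zero: "\<And>x n. sweedler (comult H x) (\<lambda>u v. g u (act v n)) = 0"
  shows "g x n = 0"
proof -
  note [linear_intros] = bilinear_left[OF g] bilinear_right[OF g]
  have scale: "sB c (g u m) = g u (sN c m)" for c u m
    using g by (auto simp: k_bilinear_def module_hom_def module_hom_axioms_def)
  have sB: "module sB"
    using g by (auto simp: k_bilinear_def module_hom_def)
  have "g x n = sweedler (comult H x) (\<lambda>u v. sB (counit H v) (g u n))"
    by (rule counit_right_sweedler[symmetric]) (simp add: linear_intros)
  also have "\<dots> = sweedler (comult H x)
      (\<lambda>u v. sweedler (comult H v) (\<lambda>p q. g u (act p (act (antipode H q) n))))"
    using antipode_right_sweedler[of sB "\<lambda>h. g _ (act h n)"]
    by (simp add: linear_intros act_mult)
  also have "\<dots> = sweedler (comult H x)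
      (\<lambda>u v. sweedler (comult H u) (\<lambda>p q. g p (act q (act (antipode H v) n))))"
    by (rule coassoc_sweedler[where sB = sB, symmetric]) (simp add: linear_intros)
  finally show ?thesis
    by (simp add: zero)
qed

end

context hopf_algebra
begin

text \<open>H acting on itself makes the cancellation available for products in H.\<close>

lemma regular_module: "hopf_module H (hscale H) (*)"
  by unfold_locales (simp add: left_module_def mult_bilinear mult.assoc)

lemma antipode_one [simp]: "antipode H 1 = 1"
  using antipode_left[of 1]
  by (simp add: comult_one sweedler_one2[where sB = "hscale H"] linear_intros counit_one)

text \<open>Both sides are left convolution inverses of the multiplication H \<otimes> H
  \<rightarrow> H: multiplied by x2 y2 on the right, S(x1 y1) and S(y1) S(x1) both give
  \<epsilon>(x) \<epsilon>(y). Their difference \<open>W\<close> is thus annihilated by this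
  convolution; one cancellation removes y2, a second removes x2.\<close>

lemma antipode_mult: "antipode H (x * y) = antipode H y * antipode H x"
proof -
  interpret hopf_module H "hscale H" "(*)" by (rule regular_module)
  interpret S: module_hom "hscale H" "hscale H" "antipode H" by (rule antipode_linear)
  define W where "W x y = antipode H (x * y) - antipode H y * antipode H x" for x y
  have [linear_intros]: "module_hom s (hscale H) (\<lambda>x. W (g x) y)" "module_hom s (hscale H) (\<lambda>x. W y (g x))"
    if "module_hom s (hscale H) g" for s :: "'k \<Rightarrow> 'h \<Rightarrow> 'h" and g y
    using that by (simp_all add: W_def linear_intros)
  have "sweedler (comult H x) (\<lambda>u v. W u y * (v * z)) = 0" for x y z
  proof (rule bilinear_cancel[where sB = "hscale H" and x = y and n = z
      and g = "\<lambda>y z. sweedler (comult H x) (\<lambda>u v. W u y * (v * z))"])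
    show "k_bilinear (hscale H) (hscale H) (hscale H) (\<lambda>y z. sweedler (comult H x) (\<lambda>u v. W u y * (v * z)))"
      by (simp add: linear_intros)
    fix y z
    have "sweedler (comult H x) (\<lambda>u v. sweedler (comult H y) (\<lambda>a b. antipode H (u * a) * (v * b) * z)) =
        hscale H (counit H (x * y)) z"
      using antipode_left_sweedler[of "hscale H" "\<lambda>h. h * z" "x * y"]
        comult_mult_sweedler[of "hscale H" "\<lambda>u v. antipode H u * v * z" x y]
      by (simp add: linear_intros)
    moreover have "sweedler (comult H y) (\<lambda>a b. sweedler (comult H x) (\<lambda>u v. antipode H a * (antipode H u * v) * b * z)) =
        hscale H (counit H x * counit H y) z"
      using antipode_left_sweedler[of "hscale H" "\<lambda>h. antipode H _ * h * _ * z" x]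
        antipode_left_sweedler[of "hscale H" "\<lambda>h. hscale H (counit H x) (h * z)" y]
      by (simp add: linear_intros mult.commute)
    ultimately show "sweedler (comult H y) (\<lambda>a b. sweedler (comult H x) (\<lambda>u v. W u a * (v * (b * z)))) = 0"
      by (subst (asm) sweedler_swap) (simp add: W_def left_diff_distrib sweedler_diff counit_mult mult.assoc)
  qed
  then have "W x y * 1 = 0"
    by (intro bilinear_cancel[where sB = "hscale H" and g = "\<lambda>x z. W x y * z" and n = 1]) (simp_all add: linear_intros)
  then show ?thesis
    by (simp add: W_def)
qed

end

section \<open>Twisting a triangular Hopf algebra\<close>

lemma twist_hopf_simps [simp]:
  "hscale (twist_hopf H F) = hscale H"
  "counit (twist_hopf H F) = counit H"
  "comult (twist_hopf H F) x =
    mult2 (hscale H) (mult2 (hscale H) F (comult H x)) (inv2 (hscale H) F)"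
  by (simp_all add: twist_hopf_def)

context k_algebra
begin

lemma is_inverse2_sym: "is_inverse2 s t t' \<Longrightarrow> t \<in> Tensor2 s \<Longrightarrow> is_inverse2 s t' t"
  by (simp add: is_inverse2_def)

lemma inv2_inv2: "invertible2 s t \<Longrightarrow> inv2 s (inv2 s t) = t"
  using inverse2_inv2 is_inverse2_sym inv2_eqI invertible2_def by metis

lemma invertible2D:
  assumes "invertible2 s t"
  shows "t \<in> Tensor2 s" "inv2 s t \<in> Tensor2 s" "mult2 s t (inv2 s t) = one2 s" "mult2 s (inv2 s t) t = one2 s"
  using assms inverse2_inv2[OF assms] by (simp_all add: invertible2_def is_inverse2_def)

lemma invertible2I: "is_inverse2 s t t' \<Longrightarrow> t \<in> Tensor2 s \<Longrightarrow> invertible2 s t"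
  by (auto simp: invertible2_def)

lemma invertible2_inv2: "invertible2 s t \<Longrightarrow> invertible2 s (inv2 s t)"
  by (rule invertible2I[of _ t]) (simp_all add: is_inverse2_def invertible2D)

end

section \<open>Cocycle identities for a twist and its inverse\<close>

context drinfeld_twist
begin

abbreviation "G \<equiv> inv2 (hscale H) F"

lemmas F_in [simp] = invertible2D(1)[OF F_invertible]
lemmas G_in [simp] = invertible2D(2)[OF F_invertible]
lemmas FG [simp] = invertible2D(3)[OF F_invertible]
lemmas GF [simp] = invertible2D(4)[OF F_invertible]
lemmas GF_cancel [simp] = mult2_cancel[OF GF]

lemma leg_inverse [simp]:
  "leg12 (hscale H) F \<odot> leg12 (hscale H) G = one3 (hscale H)"
  "leg12 (hscale H) G \<odot> leg12 (hscale H) F = one3 (hscale H)"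
  "leg13 (hscale H) F \<odot> leg13 (hscale H) G = one3 (hscale H)"
  "leg13 (hscale H) G \<odot> leg13 (hscale H) F = one3 (hscale H)"
  "leg23 (hscale H) F \<odot> leg23 (hscale H) G = one3 (hscale H)"
  "leg23 (hscale H) G \<odot> leg23 (hscale H) F = one3 (hscale H)"
  "comult_id H F \<odot> comult_id H G = one3 (hscale H)"
  "comult_id H G \<odot> comult_id H F = one3 (hscale H)"
  "id_comult H F \<odot> id_comult H G = one3 (hscale H)"
  "id_comult H G \<odot> id_comult H F = one3 (hscale H)"
  by (simp_all add: leg_one2 comult_id_one2 id_comult_one2
    flip: leg12_mult2 leg13_mult2 leg23_mult2 comult_id_mult2 id_comult_mult2)

lemmas leg_cancel [simp] = leg_inverse[THEN mult3_cancel]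

text \<open>Both sides of the cocycle condition are inverted, by inserting one side times its
  inverse and rewriting that side as the other. In this form it is the associativity constraint for
  twisted products.\<close>

lemma cocycle_inverse:
  "comult_id H G \<odot> leg12 (hscale H) G = id_comult H G \<odot> leg23 (hscale H) G"
proof -
  have "comult_id H G \<odot> leg12 (hscale H) G =
      comult_id H G \<odot> leg12 (hscale H) G \<odot> (leg23 (hscale H) F \<odot> id_comult H F) \<odot>
        (id_comult H G \<odot> leg23 (hscale H) G)"
    by (simp add: mult3_assoc)
  also have "\<dots> = id_comult H G \<odot> leg23 (hscale H) G"
    unfolding F_cocycle[symmetric] by (simp add: mult3_assoc)
  finally show ?thesis .
qed

text \<open>The left-hand sides are the words behind the products of \<beta> and its inverse. The
  right-hand sides contain only coproducts, which the antipode axioms can contract.\<close>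

lemma cocycle_mixed:
  "leg12 (hscale H) G \<odot> leg23 (hscale H) F = comult_id H F \<odot> id_comult H G"
  "leg23 (hscale H) G \<odot> leg12 (hscale H) F = id_comult H F \<odot> comult_id H G"
proof -
  have "leg12 (hscale H) G \<odot> leg23 (hscale H) F =
      leg12 (hscale H) G \<odot> (leg23 (hscale H) F \<odot> id_comult H F) \<odot> id_comult H G"
    by (simp add: mult3_assoc)
  then show "leg12 (hscale H) G \<odot> leg23 (hscale H) F = comult_id H F \<odot> id_comult H G"
    unfolding F_cocycle[symmetric] by (simp add: mult3_assoc)
  have "leg23 (hscale H) G \<odot> leg12 (hscale H) F =
      leg23 (hscale H) G \<odot> (leg12 (hscale H) F \<odot> comult_id H F) \<odot> comult_id H G"
    by (simp add: mult3_assoc)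
  then show "leg23 (hscale H) G \<odot> leg12 (hscale H) F = id_comult H F \<odot> comult_id H G"
    unfolding F_cocycle by (simp add: mult3_assoc)
qed

lemma comult_id_twist: "comult_id (twist_hopf H F) t =
    leg12 (hscale H) F \<odot> comult_id H t \<odot> leg12 (hscale H) G"
  by (rule tensor3_eqI[OF module_scale])
    (simp_all add: eval2 eval3 linear_intros comult_id_in[of "twist_hopf H F", simplified]
      sweedler_swap[of _ t])

lemma id_comult_twist: "id_comult (twist_hopf H F) t =
    leg23 (hscale H) F \<odot> id_comult H t \<odot> leg23 (hscale H) G"
  by (rule tensor3_eqI[OF module_scale])
    (simp_all add: eval2 eval3 linear_intros id_comult_in[of "twist_hopf H F", simplified]
      sweedler_swap[of _ t])

definition eps_id :: "('h \<times> 'h) multiset set \<Rightarrow> 'h" where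
  "eps_id t = sweedler t (\<lambda>u v. hscale H (counit H u) v)"

definition id_eps :: "('h \<times> 'h) multiset set \<Rightarrow> 'h" where
  "id_eps t = sweedler t (\<lambda>u v. hscale H (counit H v) u)"

text \<open>Being algebra maps, the two contractions pass the normalisation of F on to its inverse
  and give the counit laws of the twisted coproduct.\<close>

lemma eps_mult2: "eps_id (t \<bullet> t') = eps_id t * eps_id t'" "id_eps (t \<bullet> t') = id_eps t * id_eps t'"
  unfolding eps_id_def id_eps_def
  by (simp_all add: sweedler_mult2[where sB = "hscale H"] linear_intros counit_mult mult_sweedler
      scale_sweedler sweedler_swap[of t'] mult.commute)

lemma eps_one2 [simp]: "eps_id (one2 (hscale H)) = 1" "id_eps (one2 (hscale H)) = 1"
  unfolding eps_id_def id_eps_def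
  by (simp_all add: sweedler_one2[where sB = "hscale H"] linear_intros counit_one)

lemma eps_comult [simp]: "eps_id (comult H x) = x" "id_eps (comult H x) = x"
  by (simp_all add: eps_id_def id_eps_def counit_left counit_right)

lemma eps_F [simp]: "eps_id F = 1" "id_eps F = 1"
  by (simp_all add: eps_id_def id_eps_def F_counit_left F_counit_right)

lemma eps_G [simp]: "eps_id G = 1" "id_eps G = 1"
  using eps_mult2[of F G] by simp_all

section \<open>The element \<beta> and the twisted antipode\<close>

abbreviation "\<beta> \<equiv> twist_element H F"
text \<open>The inverse of \<beta>, by \<open>beta_left\<close> and \<open>beta_right\<close>; it
  replaces the definite description in \<open>twist_hopf\<close>.\<close>

definition "\<beta>' = sweedler G (\<lambda>u v. antipode H u * v)"

lemma counit_G_sweedler: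
  assumes "module_hom (hscale H) sB f"
  shows "sweedler G (\<lambda>u v. sB (counit H u) (f v)) = f 1" "sweedler G (\<lambda>u v. sB (counit H v) (f u)) = f 1"
proof -
  interpret module_hom "hscale H" sB f by fact
  show "sweedler G (\<lambda>u v. sB (counit H u) (f v)) = f 1" "sweedler G (\<lambda>u v. sB (counit H v) (f u)) = f 1"
    using module_hom_sweedler[OF assms, of G "\<lambda>u v. hscale H (counit H u) v"]
      module_hom_sweedler[OF assms, of G "\<lambda>u v. hscale H (counit H v) u"] eps_G
    by (simp_all add: scale eps_id_def id_eps_def)
qed

lemma counit_F_sweedler:
  assumes "module_hom (hscale H) sB f"
  shows "sweedler F (\<lambda>u v. sB (counit H u) (f v)) = f 1" "sweedler F (\<lambda>u v. sB (counit H v) (f u)) = f 1"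
proof -
  interpret module_hom "hscale H" sB f by fact
  show "sweedler F (\<lambda>u v. sB (counit H u) (f v)) = f 1" "sweedler F (\<lambda>u v. sB (counit H v) (f u)) = f 1"
    using module_hom_sweedler[OF assms, of F "\<lambda>u v. hscale H (counit H u) v"]
      module_hom_sweedler[OF assms, of F "\<lambda>u v. hscale H (counit H v) u"] eps_F
    by (simp_all add: scale eps_id_def id_eps_def)
qed

lemma antipode_collapse:
  "sweedler (comult H x) (\<lambda>u v. hscale H c (a * (antipode H u * (v * b)))) = hscale H c (hscale H (counit H x) (a * b))"
  "sweedler (comult H x) (\<lambda>u v. hscale H c (a * (u * (antipode H v * b)))) = hscale H c (hscale H (counit H x) (a * b))"
  using antipode_left_sweedler[of "hscale H" "\<lambda>h. hscale H c (a * h * b)" x]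
    antipode_right_sweedler[of "hscale H" "\<lambda>h. hscale H c (a * h * b)" x]
  by (simp_all add: linear_intros mult.assoc mult.commute)

text \<open>In right-nested products an absent outer factor or scalar is not visible as 1, so each
  shape needs its own instance.\<close>

lemmas antipode_collapses = antipode_collapse[of _ 1, simplified]
  antipode_collapse[of _ 1 1, simplified] antipode_collapse[of _ _ 1, simplified]
  antipode_collapse(1)[of _ 1 _ 1, simplified] antipode_collapse(2)[of _ 1 _ 1, simplified]
  antipode_collapse antipode_collapse[of _ 1 "_ * (_ * _)", unfolded mult.assoc scale_one]

lemmas counit_twist_sweedler = counit_F_sweedler[where sB = "hscale H"] counit_G_sweedler[where sB = "hscale H"]

lemmas eval_hopf = sweedler_mult2[where sB = "hscale H"] sweedler_one2[where sB = "hscale H"]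
  sweedler3_mult3[where sB = "hscale H"] sweedler3_leg12[where sB = "hscale H"]
  sweedler3_leg23[where sB = "hscale H"] sweedler3_comult_id[where sB = "hscale H"]
  sweedler3_id_comult[where sB = "hscale H"]

text \<open>After the cocycle exchange both coproducts stand next to an antipode and contract to
  counits; the normalisation of F and its inverse then leaves 1.\<close>

lemma beta_left: "\<beta>' * \<beta> = 1"
proof -
  have "\<beta>' * \<beta> = sweedler3 (leg12 (hscale H) G \<odot> leg23 (hscale H) F) (\<lambda>x y z. antipode H x * y * antipode H z)"
    unfolding \<beta>'_def twist_element_def
    by (simp add: eval_hopf linear_intros mult_sweedler mult.assoc sweedler_swap[of F])
  also have "\<dots> = 1"
    unfolding cocycle_mixed
    by (simp add: eval_hopf linear_intros antipode_mult mult.assoc antipode_collapses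
      sweedler_swap[of "comult H _" G])
      (simp add: counit_twist_sweedler linear_intros flip: scale_scale)
  finally show ?thesis .
qed

lemma beta_right: "\<beta> * \<beta>' = 1"
proof -
  have "\<beta> * \<beta>' = sweedler3 (leg23 (hscale H) G \<odot> leg12 (hscale H) F) (\<lambda>x y z. x * antipode H y * z)"
    unfolding \<beta>'_def twist_element_def
    by (simp add: eval_hopf linear_intros antipode_mult mult_sweedler mult.assoc sweedler_swap[of F])
  also have "\<dots> = 1"
    unfolding cocycle_mixed
    by (simp add: eval_hopf linear_intros antipode_mult mult.assoc antipode_collapses
      sweedler_swap[of "comult H _" G])
      (simp add: counit_twist_sweedler linear_intros flip: scale_scale)
  finally show ?thesis .
qed

lemma the_beta_inverse: "(THE b. \<beta> * b = 1 \<and> b * \<beta> = 1) = \<beta>'"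
proof (rule the_equality)
  show "\<beta> * \<beta>' = 1 \<and> \<beta>' * \<beta> = 1"
    by (simp add: beta_left beta_right)
  show "b = \<beta>'" if "\<beta> * b = 1 \<and> b * \<beta> = 1" for b
    using that beta_left by (metis mult.assoc mult.left_neutral mult.right_neutral)
qed

lemma antipode_twist: "antipode (twist_hopf H F) x = \<beta> * antipode H x * \<beta>'"
  by (simp add: twist_hopf_def the_beta_inverse)

lemma beta_cancel [simp]: "\<beta> * (\<beta>' * x) = x" "\<beta>' * (\<beta> * x) = x"
  by (simp_all add: beta_left beta_right flip: mult.assoc)

text \<open>This is S(u) v summed over G F = 1 \<otimes> 1, where antimultiplicativity of S brings
  the two factors of G together as \<open>\<beta>'\<close>. With its companion for G it absorbs the
  twist factors in the twisted antipode axioms.\<close>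

lemma antipode_F_sweedler: "sweedler F (\<lambda>u v. antipode H u * (\<beta>' * v)) = 1"
proof -
  have "sweedler (G \<bullet> F) (\<lambda>u v. antipode H u * v) = sweedler F (\<lambda>u v. antipode H u * (\<beta>' * v))"
    unfolding \<beta>'_def
    by (simp add: eval_hopf linear_intros antipode_mult mult_sweedler mult.assoc sweedler_swap[of F] del: GF)
  then show ?thesis
    by (simp add: eval_hopf linear_intros)
qed

lemma antipode_G_sweedler: "sweedler G (\<lambda>u v. u * (\<beta> * antipode H v)) = 1"
proof -
  have "sweedler (G \<bullet> F) (\<lambda>u v. u * antipode H v) = sweedler G (\<lambda>u v. u * (\<beta> * antipode H v))"
    unfolding twist_element_def
    by (simp add: eval_hopf linear_intros antipode_mult mult_sweedler mult.assoc del: GF)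
  then show ?thesis
    by (simp add: eval_hopf linear_intros)
qed

lemma twist_hopf_algebra: "hopf_algebra (twist_hopf H F)"
proof (rule hopf_algebra.intro)
  fix x y :: 'h and c :: 'k
  let ?H = "twist_hopf H F"
  show "k_bilinear (hscale ?H) (hscale ?H) (hscale ?H) (*)"
    by (simp add: mult_bilinear)
  show "comult ?H x \<in> Tensor2 (hscale ?H)"
    by simp
  show "comult ?H (x + y) = tensor2_add (hscale ?H) (comult ?H x) (comult ?H y)"
    by (rule tensor2_eqI[OF module_scale]) (simp_all add: eval2 linear_intros comult_add sweedler_add)
  show "comult ?H (hscale ?H c x) = tensor2_scale (hscale ?H) c (comult ?H x)"
    by (rule tensor2_eqI[OF module_scale]) (simp_all add: eval2 linear_intros comult_scale
      module_hom_sweedler[OF linear_scale[OF module_hom_id[OF module_universal_scale]]])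
  show "comult ?H (x * y) = mult2 (hscale ?H) (comult ?H x) (comult ?H y)"
    by (simp add: comult_mult mult2_assoc)
  show "comult ?H 1 = one2 (hscale ?H)"
    by (simp add: comult_one)
  show "comult_id ?H (comult ?H x) = id_comult ?H (comult ?H x)"
  proof -
    \<comment> \<open>The word has three blocks: the cocycle condition exchanges the left one, its
      inverse the right one, and coassociativity of the original coproduct the middle one.\<close>
    have "comult_id ?H (comult ?H x) = (leg12 (hscale H) F \<odot> comult_id H F) \<odot> comult_id H (comult H x) \<odot>
        (comult_id H G \<odot> leg12 (hscale H) G)"
      by (simp add: comult_id_twist comult_id_mult2 mult3_assoc)
    also have "\<dots> = id_comult ?H (comult ?H x)"
      by (simp add: F_cocycle cocycle_inverse coassoc id_comult_twist id_comult_mult2 mult3_assoc)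
    finally show ?thesis .
  qed
  show "module_hom (hscale ?H) (*) (counit ?H)"
    using counit_linear by simp
  show "counit ?H (x * y) = counit ?H x * counit ?H y" "counit ?H 1 = 1"
    by (simp_all add: counit_mult counit_one)
  show "sweedler (comult ?H x) (\<lambda>u v. hscale ?H (counit ?H u) v) = x"
    using eps_mult2(1)[of "F \<bullet> comult H x" G] eps_mult2(1)[of F "comult H x"]
    by (simp, simp add: eps_id_def)
  show "sweedler (comult ?H x) (\<lambda>u v. hscale ?H (counit ?H v) u) = x"
    using eps_mult2(2)[of "F \<bullet> comult H x" G] eps_mult2(2)[of F "comult H x"]
    by (simp, simp add: id_eps_def)
  show "module_hom (hscale ?H) (hscale ?H) (antipode ?H)"
    by (simp add: antipode_twist[abs_def] linear_intros)
  show "bij (antipode ?H)"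
  proof -
    have "bij (\<lambda>x. \<beta> * x * \<beta>')"
      by (rule o_bij[of "\<lambda>x. \<beta>' * x * \<beta>"])
        (simp_all add: fun_eq_iff mult.assoc beta_left beta_right)
    then have "bij ((\<lambda>x. \<beta> * x * \<beta>') \<circ> antipode H)"
      using antipode_bij by (rule bij_comp[rotated])
    then show ?thesis
      by (simp add: comp_def antipode_twist[abs_def])
  qed
  \<comment> \<open>The antipode axioms contract from the middle outwards. For the left one
    \<open>F\<close> removes the sum over the twist, the axiom for S removes \<Delta>(x), and
    \<open>G'\<close> recognises what remains as \<beta> times its inverse. For the right one
    \<open>G\<close> comes first and \<open>F'\<close> last.\<close>
  have F: "sweedler F (\<lambda>u v. \<beta> * (p * (p' * (antipode H u * (\<beta>' * (v * q)))))) = \<beta> * (p * (p' * q))" for p p' q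
    using arg_cong[OF antipode_F_sweedler, of "\<lambda>h. \<beta> * (p * (p' * (h * q)))"]
    by (simp add: mult_sweedler mult.assoc)
  have G: "sweedler G (\<lambda>u v. p * (u * (\<beta> * (antipode H v * q)))) = p * q" for p q
    using arg_cong[OF antipode_G_sweedler, of "\<lambda>h. p * (h * q)"]
    by (simp add: mult_sweedler mult.assoc)
  have G': "sweedler G (\<lambda>u v. hscale H c (\<beta> * (antipode H u * v))) = hscale H c 1" for c
    using arg_cong[OF beta_right, of "hscale H c"]
    by (simp add: \<beta>'_def mult_sweedler mult.assoc scale_sweedler)
  have F': "sweedler F (\<lambda>u v. hscale H c (u * (antipode H v * \<beta>'))) = hscale H c 1" for c
    using arg_cong[OF beta_right, of "hscale H c"]
    by (simp add: twist_element_def mult_sweedler mult.assoc scale_sweedler)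
  show "sweedler (comult ?H x) (\<lambda>u v. antipode ?H u * v) = hscale ?H (counit ?H x) 1"
    by (simp add: eval_hopf linear_intros antipode_twist antipode_mult mult.assoc
      sweedler_swap[of F] sweedler_swap[of "comult H x" G] F G' antipode_collapses
      antipode_collapse[of _ 1 "_ * _", unfolded mult.assoc scale_one])
  show "sweedler (comult ?H x) (\<lambda>u v. u * antipode ?H v) = hscale ?H (counit ?H x) 1"
    by (simp add: eval_hopf linear_intros antipode_twist antipode_mult mult.assoc G F' antipode_collapses)
qed

end

section \<open>Triangular structures and their inverses\<close>

context triangular_hopf_algebra
begin

abbreviation "R' \<equiv> inv2 (hscale H) R"

lemmas R_in [simp] = invertible2D(1)[OF R_invertible]
lemmas RR' [simp] = invertible2D(3)[OF R_invertible]
lemmas R'R [simp] = invertible2D(4)[OF R_invertible]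
lemmas RR'_cancel [simp] = mult2_cancel[OF RR']
lemmas R'R_cancel [simp] = mult2_cancel[OF R'R]

lemma flip_R [simp]: "flip (hscale H) R = R'"
  by (simp add: R_triangular)

lemma R_comult': "R \<bullet> comult H x = flip (hscale H) (comult H x) \<bullet> R"
  by (simp add: R_comult mult2_assoc)

lemma R'_comult: "R' \<bullet> flip (hscale H) (comult H x) = comult H x \<bullet> R'"
  by (simp add: R_comult mult2_assoc)

lemma R'_comult_sweedler:
  assumes f: "k_bilinear (hscale H) (hscale H) sB f"
  shows "sweedler (comult H x) (\<lambda>u v. sweedler R' (\<lambda>p q. f (p * v) (q * u))) =
    sweedler (comult H x) (\<lambda>u v. sweedler R' (\<lambda>p q. f (u * p) (v * q)))"
proof -
  note [linear_intros] = bilinear_left[OF f] bilinear_right[OF f]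
  from arg_cong[OF R'_comult[of x], of "\<lambda>t. sweedler t f"] show ?thesis
    by (simp add: sweedler_mult2[where sB = sB] sweedler_flip[where sB = sB] linear_intros
      sweedler_swap[of R'])
qed

text \<open>Inversion reverses the two factors. The braided Leibniz rule involves the inverse of R,
  so this is the hexagon needed for multiples of derivations.\<close>

lemma R'_id_comult: "id_comult H R' = leg12 (hscale H) R' \<odot> leg13 (hscale H) R'"
proof -
  have "leg12 (hscale H) R \<odot> leg12 (hscale H) R' = one3 (hscale H)"
    "leg13 (hscale H) R \<odot> leg13 (hscale H) R' = one3 (hscale H)"
    "id_comult H R' \<odot> id_comult H R = one3 (hscale H)"
    by (simp_all add: leg_one2 id_comult_one2 flip: leg12_mult2 leg13_mult2 id_comult_mult2)
  note inv = this this[THEN mult3_cancel]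
  have "id_comult H R' =
      id_comult H R' \<odot> (leg13 (hscale H) R \<odot> leg12 (hscale H) R) \<odot> (leg12 (hscale H) R' \<odot> leg13 (hscale H) R')"
    by (simp add: mult3_assoc inv)
  then show ?thesis
    unfolding R_id_comult[symmetric] inv by simp
qed

lemma R'_id_comult_sweedler:
  assumes f: "k_trilinear (hscale H) sB f"
  shows "sweedler R' (\<lambda>r t. sweedler (comult H t) (\<lambda>u v. f r u v)) =
    sweedler R' (\<lambda>p q. sweedler R' (\<lambda>r t. f (p * r) q t))"
proof -
  note [linear_intros] = trilinear_arg1[OF f] trilinear_arg2[OF f] trilinear_arg3[OF f]
  show ?thesis
    using arg_cong[OF R'_id_comult, of "\<lambda>t. sweedler3 t f"]
    by (simp add: sweedler3_mult3[where sB = sB] sweedler3_id_comult[where sB = sB]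
      sweedler3_leg12[where sB = sB] sweedler3_leg13[where sB = sB] linear_intros)
qed

end

section \<open>The twisted triangular structure\<close>

locale twisted_triangular = triangular_hopf_algebra H R + drinfeld_twist H F
  for H :: "('k::comm_ring_1, 'h::ring_1) hopf_data" and R F
begin

abbreviation "F\<^sub>2\<^sub>1 \<equiv> flip (hscale H) F"
abbreviation "G\<^sub>2\<^sub>1 \<equiv> flip (hscale H) G"

lemma flip_inverse [simp]: "F\<^sub>2\<^sub>1 \<bullet> G\<^sub>2\<^sub>1 = one2 (hscale H)" "G\<^sub>2\<^sub>1 \<bullet> F\<^sub>2\<^sub>1 = one2 (hscale H)"
  by (simp_all flip: flip_mult2)

lemmas flip_cancel [simp] = flip_inverse[THEN mult2_cancel]

lemma leg_flip_inverse [simp]: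
  "leg12 (hscale H) F\<^sub>2\<^sub>1 \<odot> leg12 (hscale H) G\<^sub>2\<^sub>1 = one3 (hscale H)"
  "leg13 (hscale H) F\<^sub>2\<^sub>1 \<odot> leg13 (hscale H) G\<^sub>2\<^sub>1 = one3 (hscale H)"
  "leg23 (hscale H) F\<^sub>2\<^sub>1 \<odot> leg23 (hscale H) G\<^sub>2\<^sub>1 = one3 (hscale H)"
  "leg12 (hscale H) G\<^sub>2\<^sub>1 \<odot> leg12 (hscale H) F\<^sub>2\<^sub>1 = one3 (hscale H)"
  "leg13 (hscale H) G\<^sub>2\<^sub>1 \<odot> leg13 (hscale H) F\<^sub>2\<^sub>1 = one3 (hscale H)"
  "leg23 (hscale H) G\<^sub>2\<^sub>1 \<odot> leg23 (hscale H) F\<^sub>2\<^sub>1 = one3 (hscale H)"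
  by (simp_all add: leg_one2 flip: leg12_mult2 leg13_mult2 leg23_mult2)

lemmas leg_flip_cancel [simp] = leg_flip_inverse[THEN mult3_cancel]

lemma twist_R_inverse: "is_inverse2 (hscale H) (twist_R H F R) (F \<bullet> R' \<bullet> G\<^sub>2\<^sub>1)"
  unfolding is_inverse2_def twist_R_def by (simp add: mult2_assoc)

lemma inv2_twist_R: "inv2 (hscale H) (twist_R H F R) = F \<bullet> R' \<bullet> G\<^sub>2\<^sub>1"
  by (rule inv2_eqI[OF twist_R_inverse])

text \<open>Quasi-commutativity with the third leg as a spectator: R passes a coproduct of
  \<open>t\<close> at the price of a transposition.\<close>

lemma R_comult_leg12:
  "leg12 (hscale H) R \<odot> comult_id H t = swap12 (hscale H) (comult_id H t) \<odot> leg12 (hscale H) R"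
proof (rule tensor3_eqI[OF module_scale])
  have "sweedler R (\<lambda>a b. sweedler (comult H x) (\<lambda>c d. pure3 (hscale H) (a * c) (b * d) y)) =
    sweedler (comult H x) (\<lambda>c d. sweedler R (\<lambda>a b. pure3 (hscale H) (d * a) (c * b) y))" for x y
    using arg_cong[OF R_comult'[of x], of "\<lambda>t. sweedler t (\<lambda>a b. pure3 (hscale H) a b y)"]
    by (simp add: eval2 linear_intros)
  then show "sweedler3 (leg12 (hscale H) R \<odot> comult_id H t) (pure3 (hscale H)) =
    sweedler3 (swap12 (hscale H) (comult_id H t) \<odot> leg12 (hscale H) R) (pure3 (hscale H))"
    by (simp add: eval3 linear_intros sweedler_swap[of R])
qed simp_all

lemma R_comult_leg23:
  "leg23 (hscale H) R \<odot> id_comult H t = swap23 (hscale H) (id_comult H t) \<odot> leg23 (hscale H) R"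
proof (rule tensor3_eqI[OF module_scale])
  have "sweedler R (\<lambda>a b. sweedler (comult H x) (\<lambda>c d. pure3 (hscale H) y (a * c) (b * d))) =
    sweedler (comult H x) (\<lambda>c d. sweedler R (\<lambda>a b. pure3 (hscale H) y (d * a) (c * b)))" for x y
    using arg_cong[OF R_comult'[of x], of "\<lambda>t. sweedler t (\<lambda>a b. pure3 (hscale H) y a b)"]
    by (simp add: eval2 linear_intros)
  then show "sweedler3 (leg23 (hscale H) R \<odot> id_comult H t) (pure3 (hscale H)) =
    sweedler3 (swap23 (hscale H) (id_comult H t) \<odot> leg23 (hscale H) R) (pure3 (hscale H))"
    by (simp add: eval3 linear_intros sweedler_swap[of R])
qed simp_all

lemma twist_R_comult_id:
  "comult_id (twist_hopf H F) (twist_R H F R) =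
    leg13 (hscale H) (twist_R H F R) \<odot> leg23 (hscale H) (twist_R H F R)"
proof -
  let ?s = "hscale H"
  let ?D = "comult_id H F" and ?swap = "swap23 ?s (swap12 ?s (comult_id H F))"
  \<comment> \<open>Facts 1 and 3 are leg permutations of the cocycle condition, 2 and 4 come from
    quasi-commutativity. Used alternately, they carry a coproduct of F to the right past
    \<open>leg13 ?s R\<close> and \<open>leg23 ?s R\<close>, leaving the factors of the twisted R
    behind; the cocycle condition finally cancels it against the inverse factors.\<close>
  have 1: "leg12 ?s F \<odot> comult_id H F\<^sub>2\<^sub>1 = leg13 ?s F\<^sub>2\<^sub>1 \<odot> ?swap"
    using arg_cong[OF F_cocycle, of "\<lambda>t. swap23 ?s (swap12 ?s t)"]
    by (simp add: swap12_mult3 swap23_mult3 swap12_legs swap23_legs comult_id_flip)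
  have 2: "?swap \<odot> leg13 ?s R = leg13 ?s R \<odot> swap23 ?s ?D"
    using arg_cong[OF R_comult_leg12, of "swap23 ?s" F]
    by (simp add: swap12_mult3 swap23_mult3 swap12_legs swap23_legs)
  have 3: "leg13 ?s F \<odot> swap23 ?s ?D = leg23 ?s F\<^sub>2\<^sub>1 \<odot> swap23 ?s (id_comult H F)"
    using arg_cong[OF F_cocycle, of "swap23 ?s"]
    by (simp add: swap12_mult3 swap23_mult3 swap12_legs swap23_legs)
  have 4: "swap23 ?s (id_comult H F) \<odot> leg23 ?s R = leg23 ?s R \<odot> id_comult H F"
    by (simp add: R_comult_leg23)
  have "comult_id (twist_hopf H F) (twist_R H F R) =
      (leg12 ?s F \<odot> comult_id H F\<^sub>2\<^sub>1) \<odot> leg13 ?s R \<odot> leg23 ?s R \<odot> comult_id H G \<odot> leg12 ?s G"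
    by (simp add: comult_id_twist twist_R_def comult_id_mult2 R_comult_id mult3_assoc)
  also have "\<dots> = leg13 ?s F\<^sub>2\<^sub>1 \<odot> (?swap \<odot> leg13 ?s R) \<odot> leg23 ?s R \<odot> comult_id H G \<odot> leg12 ?s G"
    unfolding 1 by (simp add: mult3_assoc)
  also have "\<dots> = leg13 ?s F\<^sub>2\<^sub>1 \<odot> leg13 ?s R \<odot> leg13 ?s G \<odot> (leg13 ?s F \<odot> swap23 ?s ?D) \<odot>
      leg23 ?s R \<odot> comult_id H G \<odot> leg12 ?s G"
    unfolding 2 by (simp add: mult3_assoc)
  also have "\<dots> = leg13 ?s F\<^sub>2\<^sub>1 \<odot> leg13 ?s R \<odot> leg13 ?s G \<odot> leg23 ?s F\<^sub>2\<^sub>1 \<odot>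
      (swap23 ?s (id_comult H F) \<odot> leg23 ?s R) \<odot> comult_id H G \<odot> leg12 ?s G"
    unfolding 3 by (simp add: mult3_assoc)
  also have "\<dots> = leg13 ?s F\<^sub>2\<^sub>1 \<odot> leg13 ?s R \<odot> leg13 ?s G \<odot> leg23 ?s F\<^sub>2\<^sub>1 \<odot> leg23 ?s R \<odot> leg23 ?s G \<odot>
      (leg23 ?s F \<odot> id_comult H F) \<odot> comult_id H G \<odot> leg12 ?s G"
    unfolding 4 by (simp add: mult3_assoc)
  also have "\<dots> = leg13 ?s F\<^sub>2\<^sub>1 \<odot> leg13 ?s R \<odot> leg13 ?s G \<odot> leg23 ?s F\<^sub>2\<^sub>1 \<odot> leg23 ?s R \<odot> leg23 ?s G"
    unfolding F_cocycle[symmetric] by (simp add: mult3_assoc)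
  also have "\<dots> = leg13 ?s (twist_R H F R) \<odot> leg23 ?s (twist_R H F R)"
    by (simp add: twist_R_def leg13_mult2 leg23_mult2 mult3_assoc)
  finally show ?thesis .
qed

lemma twist_R_flip: "flip (hscale H) (twist_R H F R) = inv2 (hscale H) (twist_R H F R)"
  unfolding inv2_twist_R by (simp add: twist_R_def flip_mult2 mult2_assoc)

text \<open>In the triangular case one hexagon implies the other: the twisted R is the flip of its
  inverse, and id \<otimes> \<Delta> of a flip is a leg permutation of \<Delta> \<otimes> id. It
  remains to invert the first hexagon and permute the legs.\<close>

lemma twist_R_id_comult:
  "id_comult (twist_hopf H F) (twist_R H F R) =
    leg13 (hscale H) (twist_R H F R) \<odot> leg12 (hscale H) (twist_R H F R)"
proof -
  interpret twist: hopf_algebra "twist_hopf H F" by (rule twist_hopf_algebra)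
  let ?s = "hscale H" and ?R = "twist_R H F R"
  let ?R' = "inv2 ?s ?R"
  have inv: "?R \<bullet> ?R' = one2 ?s" "?R' \<bullet> ?R = one2 ?s"
    using twist_R_inverse by (simp_all add: inv2_twist_R is_inverse2_def)
  note leg_inv = legs_mult_eq_one[OF inv(1)] legs_mult_eq_one[OF inv(2)]
  have R: "?R = flip ?s ?R'"
    unfolding twist_R_flip[symmetric] by (simp add: twist_R_def)
  have "comult_id (twist_hopf H F) ?R' \<odot> comult_id (twist_hopf H F) ?R = one3 ?s"
    using twist.comult_id_mult2[of ?R' ?R] twist.comult_id_one2 inv by simp
  then have 1: "comult_id (twist_hopf H F) ?R' \<odot> (leg13 ?s ?R \<odot> leg23 ?s ?R) = one3 ?s"
    unfolding twist_R_comult_id .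
  have "comult_id (twist_hopf H F) ?R' =
      comult_id (twist_hopf H F) ?R' \<odot> (leg13 ?s ?R \<odot> leg23 ?s ?R) \<odot> (leg23 ?s ?R' \<odot> leg13 ?s ?R')"
    using comult_id_in[of "twist_hopf H F" ?R']
    by (simp add: mult3_assoc leg_inv leg_inv[THEN mult3_cancel])
  then have "comult_id (twist_hopf H F) ?R' = leg23 ?s ?R' \<odot> leg13 ?s ?R'"
    unfolding 1 by simp
  moreover have "id_comult (twist_hopf H F) ?R = swap12 ?s (swap23 ?s (comult_id (twist_hopf H F) ?R'))"
    using twist.id_comult_flip[of ?R'] R by simp
  ultimately show ?thesis
    using R by (simp add: swap12_mult3 swap23_mult3 swap12_legs swap23_legs)
qed

lemma twist_triangular: "triangular_hopf_algebra (twist_hopf H F) (twist_R H F R)"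
proof (intro triangular_hopf_algebra.intro triangular_hopf_algebra_axioms.intro)
  let ?H = "twist_hopf H F" and ?R = "twist_R H F R"
  show "hopf_algebra ?H"
    by (rule twist_hopf_algebra)
  show "invertible2 (hscale ?H) ?R"
    using twist_R_inverse by (auto simp: invertible2_def twist_R_def)
  show "inv2 (hscale ?H) ?R = flip (hscale ?H) ?R"
    by (simp add: twist_R_flip)
  show "flip (hscale ?H) (comult ?H x) =
      mult2 (hscale ?H) (mult2 (hscale ?H) ?R (comult ?H x)) (inv2 (hscale ?H) ?R)" for x
    by (simp add: inv2_twist_R) (simp add: twist_R_def flip_mult2 R_comult mult2_assoc)
  show "comult_id ?H ?R = mult3 (hscale ?H) (leg13 (hscale ?H) ?R) (leg23 (hscale ?H) ?R)"
    by (simp add: twist_R_comult_id)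
  show "id_comult ?H ?R = mult3 (hscale ?H) (leg13 (hscale ?H) ?R) (leg12 (hscale ?H) ?R)"
    by (simp add: twist_R_id_comult)
qed

end

section \<open>Undoing a twist\<close>

lemma antipode_unique:
  assumes "hopf_algebra H" "hopf_algebra H'"
    and eq: "hscale H' = hscale H" "comult H' = comult H" "counit H' = counit H"
  shows "antipode H' = antipode H"
proof
  fix x
  interpret hopf_algebra H by fact
  interpret H': hopf_algebra H' by fact
  interpret hopf_module H "hscale H" "(*)" by (rule regular_module)
  have [linear_intros]: "module_hom s (hscale H) (\<lambda>x. antipode H' (g x))" if "module_hom s (hscale H) g" for s :: "'a \<Rightarrow> 'b \<Rightarrow> 'b" and g
    using H'.linear_antipode that eq by metis
  \<comment> \<open>Both antipodes are left convolution inverses of the identity, so their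
    difference convolved with it vanishes. The factor 1 is the module element to which the
    cancellation is applied.\<close>
  have "(antipode H' x - antipode H x) * 1 = 0"
  proof (rule bilinear_cancel[where g = "\<lambda>x n. (antipode H' x - antipode H x) * n" and sB = "hscale H"])
    show "k_bilinear (hscale H) (hscale H) (hscale H) (\<lambda>x n. (antipode H' x - antipode H x) * n)"
      by (simp add: linear_intros)
    show "sweedler (comult H x) (\<lambda>u v. (antipode H' u - antipode H u) * (v * n)) = 0" for x n
      using antipode_left_sweedler[of "hscale H" "\<lambda>h. h * n" x] H'.antipode_left_sweedler[of "hscale H" "\<lambda>h. h * n" x]
      by (simp add: eq linear_intros sweedler_diff left_diff_distrib flip: mult.assoc)
  qed
  then show "antipode H' x = antipode H x"
    by simp
qed

context drinfeld_twist
begin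

text \<open>In H_F the maps \<Delta> \<otimes> id and id \<otimes> \<Delta> are conjugated by legs
  of F. The legs of G in front cancel one half of each conjugation, and
  \<open>cocycle_inverse\<close> is what remains.\<close>

lemma inverse_twist: "drinfeld_twist (twist_hopf H F) G"
proof (intro drinfeld_twist.intro drinfeld_twist_axioms.intro)
  let ?H = "twist_hopf H F"
  show "hopf_algebra ?H"
    by (rule twist_hopf_algebra)
  show "invertible2 (hscale ?H) G"
    by (simp add: F_invertible invertible2_inv2)
  show "mult3 (hscale ?H) (leg12 (hscale ?H) G) (comult_id ?H G) =
      mult3 (hscale ?H) (leg23 (hscale ?H) G) (id_comult ?H G)"
    by (simp add: comult_id_twist id_comult_twist mult3_assoc cocycle_inverse)
  show "sweedler G (\<lambda>u v. hscale ?H (counit ?H u) v) = 1" "sweedler G (\<lambda>u v. hscale ?H (counit ?H v) u) = 1"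
    using eps_G by (simp_all add: eps_id_def id_eps_def)
qed

lemma inv2_G: "inv2 (hscale H) G = F"
  by (rule inv2_inv2[OF F_invertible])

text \<open>The coproduct returns by cancellation. For the antipode, uniqueness replaces a
  computation with the \<beta>-elements of both twists.\<close>

lemma twist_hopf_inverse: "twist_hopf (twist_hopf H F) G = H"
proof -
  interpret inverse: drinfeld_twist "twist_hopf H F" G
    by (rule inverse_twist)
  have eq: "hscale (twist_hopf (twist_hopf H F) G) = hscale H"
    "comult (twist_hopf (twist_hopf H F) G) = comult H"
    "counit (twist_hopf (twist_hopf H F) G) = counit H"
    by (simp_all add: fun_eq_iff inv2_G mult2_assoc)
  moreover have "antipode (twist_hopf (twist_hopf H F) G) = antipode H"
    by (rule antipode_unique[OF hopf_algebra_axioms inverse.twist_hopf_algebra eq])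
  ultimately show ?thesis
    by (intro hopf_data.equality) simp_all
qed

end

lemma (in twisted_triangular) twist_R_inverse_twist: "twist_R (twist_hopf H F) G (twist_R H F R) = R"
  by (simp add: twist_R_def inv2_G mult2_assoc)

declare twist_hopf_simps(3) [simp del]

section \<open>Twisting module algebras and bimodules\<close>

sublocale module_algebra \<subseteq> A: hopf_module H "ascale A" "aact A"
  by unfold_locales (rule aact_module)

context module_algebra
begin

lemmas linear_amult [linear_intros] = bilinear_left[OF amult_bilinear] bilinear_right[OF amult_bilinear]
lemmas amult_sweedler = bilinear_sweedler_left[OF amult_bilinear] bilinear_sweedler_right[OF amult_bilinear]

lemma amult_scale [simp]:
  "amult A (ascale A c a) b = ascale A c (amult A a b)"
  "amult A a (ascale A c b) = ascale A c (amult A a b)"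
  using amult_bilinear by (auto simp: k_bilinear_def module_hom_def module_hom_axioms_def)

lemma amult_add:
  "amult A (a + b) c = amult A a c + amult A b c"
  "amult A a (b + c) = amult A a b + amult A a c"
  using amult_bilinear by (auto simp: k_bilinear_def module_hom_def module_hom_axioms_def)

end

lemma twist_algebra_simps [simp]:
  "ascale (twist_algebra H F A) = ascale A"
  "aone (twist_algebra H F A) = aone A"
  "aact (twist_algebra H F A) = aact A"
  "amult (twist_algebra H F A) a b =
    sweedler (inv2 (hscale H) F) (\<lambda>u v. amult A (aact A u a) (aact A v b))"
  by (simp_all add: twist_algebra_def)

lemma left_module_twist [simp]: "left_module (twist_hopf H F) s act = left_module H s act"
  by (simp add: left_module_def)

context drinfeld_twist
begin

text \<open>The order of summation, with the coproduct innermost, is the one that arises when a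
  twisted operation is nested in another and equivariance is expanded.\<close>

lemma cocycle_sweedler:
  assumes f: "k_trilinear (hscale H) sB f"
  shows "sweedler G (\<lambda>x z. sweedler G (\<lambda>p q. sweedler (comult H x) (\<lambda>u v. f (u * p) (v * q) z))) =
    sweedler G (\<lambda>x z. sweedler G (\<lambda>p q. sweedler (comult H z) (\<lambda>u v. f x (u * p) (v * q))))"
proof -
  note [linear_intros] = trilinear_arg1[OF f] trilinear_arg2[OF f] trilinear_arg3[OF f]
  show ?thesis
    using arg_cong[OF cocycle_inverse, of "\<lambda>t. sweedler3 t f"]
    by (simp add: sweedler3_mult3[where sB = sB] sweedler3_comult_id[where sB = sB]
      sweedler3_id_comult[where sB = sB] sweedler3_leg12[where sB = sB] sweedler3_leg23[where sB = sB]
      linear_intros sweedler_swap[of "comult H _" G])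
qed

text \<open>The form in which the twisted coproduct, no longer unfolded by the simplifier, enters
  the arguments below: of the twist only the inverse is left.\<close>

lemma twist_comult_sweedler:
  assumes f: "k_bilinear (hscale H) (hscale H) sB f"
  shows "sweedler G (\<lambda>p q. sweedler (comult (twist_hopf H F) x) (\<lambda>u v. f (p * u) (q * v))) =
    sweedler G (\<lambda>p q. sweedler (comult H x) (\<lambda>u v. f (u * p) (v * q)))"
proof -
  have "G \<bullet> comult (twist_hopf H F) x = comult H x \<bullet> G"
    by (simp add: twist_hopf_simps mult2_assoc)
  from arg_cong[OF this, of "\<lambda>t. sweedler t f"] show ?thesis
    by (simp add: sweedler_mult2[OF f] sweedler_swap[of "comult H _" G])
qed

end

lemma (in twisted_triangular) twist_R_sweedler:
  assumes f: "k_bilinear (hscale H) (hscale H) sB f"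
  shows "sweedler G (\<lambda>p q. sweedler (inv2 (hscale H) (twist_R H F R)) (\<lambda>u v. f (p * u) (q * v))) =
    sweedler R' (\<lambda>u v. sweedler G (\<lambda>p q. f (u * q) (v * p)))"
proof -
  note [linear_intros] = bilinear_left[OF f] bilinear_right[OF f]
  have "G \<bullet> inv2 (hscale H) (twist_R H F R) = R' \<bullet> G\<^sub>2\<^sub>1"
    by (simp add: inv2_twist_R mult2_assoc)
  from arg_cong[OF this, of "\<lambda>t. sweedler t f"] show ?thesis
    by (simp add: sweedler_mult2[where sB = sB] sweedler_flip[where sB = sB] linear_intros)
qed

locale twisted_module_algebra = module_algebra H A + drinfeld_twist H F
  for H :: "('k::comm_ring_1, 'h::ring_1) hopf_data"
    and A :: "('k, 'h, 'a::ab_group_add) algebra_data" and F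
begin

abbreviation "A\<^sub>F \<equiv> twist_algebra H F A"

lemma twist_amult_bilinear: "k_bilinear (ascale A) (ascale A) (ascale A) (amult A\<^sub>F)"
  by (rule k_bilinearI) (simp_all add: linear_intros)

lemma twist_module_algebra: "module_algebra (twist_hopf H F) A\<^sub>F"
proof (intro module_algebra.intro module_algebra_axioms.intro)
  show "hopf_algebra (twist_hopf H F)"
    by (rule twist_hopf_algebra)
  show "k_bilinear (ascale A\<^sub>F) (ascale A\<^sub>F) (ascale A\<^sub>F) (amult A\<^sub>F)"
    using twist_amult_bilinear by simp
  fix a b c :: 'a and x :: 'h
  show "amult A\<^sub>F (amult A\<^sub>F a b) c = amult A\<^sub>F a (amult A\<^sub>F b c)"
    using cocycle_sweedler[of "ascale A" "\<lambda>x y z. amult A (amult A (aact A x a) (aact A y b)) (aact A z c)"]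
    by (simp add: linear_intros amult_sweedler A.act_sweedler aact_mult A.act_mult amult_assoc)
  show "amult A\<^sub>F (aone A\<^sub>F) a = a" "amult A\<^sub>F a (aone A\<^sub>F) = a"
    using counit_G_sweedler[of "ascale A" "\<lambda>h. aact A h a"]
    by (simp_all add: linear_intros aact_one aone_left aone_right)
  show "left_module (twist_hopf H F) (ascale A\<^sub>F) (aact A\<^sub>F)"
    by (simp add: aact_module)
  show "aact A\<^sub>F x (amult A\<^sub>F a b) =
      sweedler (comult (twist_hopf H F) x) (\<lambda>u v. amult A\<^sub>F (aact A\<^sub>F u a) (aact A\<^sub>F v b))"
    using twist_comult_sweedler[of "ascale A" "\<lambda>x y. amult A (aact A x a) (aact A y b)" x]
    by (simp add: linear_intros A.act_sweedler aact_mult A.act_mult sweedler_swap[of "comult (twist_hopf H F) _" G])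
  show "aact A\<^sub>F x (aone A\<^sub>F) = ascale A\<^sub>F (counit (twist_hopf H F) x) (aone A\<^sub>F)"
    by (simp add: aact_one)
qed

end

locale twisted_braided_algebra = braided_commutative_module_algebra H R A + drinfeld_twist H F
  for H :: "('k::comm_ring_1, 'h::ring_1) hopf_data" and R
    and A :: "('k, 'h, 'a::ab_group_add) algebra_data" and F
begin

sublocale twisted_triangular H R F ..
sublocale twisted_module_algebra H A F ..

lemma twist_braided_algebra:
  "braided_commutative_module_algebra (twist_hopf H F) (twist_R H F R) A\<^sub>F"
proof (intro braided_commutative_module_algebra.intro braided_commutative_module_algebra_axioms.intro)
  show "triangular_hopf_algebra (twist_hopf H F) (twist_R H F R)"
    by (rule twist_triangular)
  show "module_algebra (twist_hopf H F) A\<^sub>F"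
    by (rule twist_module_algebra)
  show "amult A\<^sub>F b a = sweedler (inv2 (hscale (twist_hopf H F)) (twist_R H F R))
      (\<lambda>u v. amult A\<^sub>F (aact A\<^sub>F u a) (aact A\<^sub>F v b))" for a b
    using twist_R_sweedler[of "ascale A" "\<lambda>x y. amult A (aact A x a) (aact A y b)"]
    by (simp add: linear_intros A.act_mult braided_commutative[of "aact A _ b"]
      sweedler_swap[of "inv2 _ (twist_R H F R)" G] sweedler_swap[of R' G])
qed

end

locale twisted_bimodule = equivariant_braided_symmetric_bimodule H R A M + drinfeld_twist H F
  for H :: "('k::comm_ring_1, 'h::ring_1) hopf_data" and R
    and A :: "('k, 'h, 'a::ab_group_add) algebra_data"
    and M :: "('k, 'h, 'a, 'm::ab_group_add) bimodule_data" and F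

sublocale equivariant_braided_symmetric_bimodule \<subseteq> M: hopf_module H "mscale M" "mact M"
  by unfold_locales (rule mact_module)

sublocale twisted_bimodule \<subseteq> twisted_braided_algebra H R A F ..

lemma twist_bimodule_simps [simp]:
  "mscale (twist_bimodule H F A M) = mscale M"
  "mact (twist_bimodule H F A M) = mact M"
  "lmult (twist_bimodule H F A M) a m =
    sweedler (inv2 (hscale H) F) (\<lambda>u v. lmult M (aact A u a) (mact M v m))"
  "rmult (twist_bimodule H F A M) m a =
    sweedler (inv2 (hscale H) F) (\<lambda>u v. rmult M (mact M u m) (aact A v a))"
  by (simp_all add: twist_bimodule_def)

context equivariant_braided_symmetric_bimodule
begin

lemmas linear_lmult [linear_intros] = bilinear_left[OF lmult_bilinear] bilinear_right[OF lmult_bilinear]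
lemmas lmult_sweedler = bilinear_sweedler_left[OF lmult_bilinear] bilinear_sweedler_right[OF lmult_bilinear]
lemmas linear_rmult [linear_intros] = bilinear_left[OF rmult_bilinear] bilinear_right[OF rmult_bilinear]
lemmas rmult_sweedler = bilinear_sweedler_left[OF rmult_bilinear] bilinear_sweedler_right[OF rmult_bilinear]

lemma lmult_scale [simp]:
  "lmult M (ascale A c a) m = mscale M c (lmult M a m)"
  "lmult M a (mscale M c m) = mscale M c (lmult M a m)"
  using lmult_bilinear by (auto simp: k_bilinear_def module_hom_def module_hom_axioms_def)

lemma rmult_scale [simp]:
  "rmult M (mscale M c m) a = mscale M c (rmult M m a)"
  "rmult M m (ascale A c a) = mscale M c (rmult M m a)"
  using rmult_bilinear by (auto simp: k_bilinear_def module_hom_def module_hom_axioms_def)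

text \<open>The equivariance axiom at b = 1: H acts on the unit through the counit, which contracts
  the third leg. For \<open>mact_rmult\<close> the first leg is contracted, after
  coassociativity.\<close>

lemma mact_lmult: "mact M x (lmult M a m) = sweedler (comult H x) (\<lambda>u v. lmult M (aact A u a) (mact M v m))"
  using mact_equivariant[of x a m "aone A"]
    counit_right_sweedler[of "mscale M" "\<lambda>y. sweedler (comult H y) (\<lambda>u v. lmult M (aact A u a) (mact M v m))" x]
  by (simp add: rmult_one aact_one sweedler3_comult_id[where sB = "mscale M"] linear_intros
    module_hom_sweedler[OF linear_scale[OF module_hom_id[OF M.module_sN]]])

lemma mact_rmult: "mact M x (rmult M m a) = sweedler (comult H x) (\<lambda>u v. rmult M (mact M u m) (aact A v a))"
  using mact_equivariant[of x "aone A" m a]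
    counit_left_sweedler[of "mscale M" "\<lambda>y. sweedler (comult H y) (\<lambda>u v. rmult M (mact M u m) (aact A v a))" x]
  by (simp add: lmult_one aact_one coassoc sweedler3_id_comult[where sB = "mscale M"] linear_intros
    module_hom_sweedler[OF linear_scale[OF module_hom_id[OF M.module_sN]]])

end

context twisted_bimodule
begin

abbreviation "M\<^sub>F \<equiv> twist_bimodule H F A M"

lemma twist_mact_lmult: "mact M x (lmult M\<^sub>F a m) =
    sweedler (comult (twist_hopf H F) x) (\<lambda>u v. lmult M\<^sub>F (aact A u a) (mact M v m))"
  using twist_comult_sweedler[of "mscale M" "\<lambda>x y. lmult M (aact A x a) (mact M y m)" x]
  by (simp add: linear_intros M.act_sweedler mact_lmult A.act_mult M.act_mult sweedler_swap[of "comult (twist_hopf H F) _" G])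

lemma twist_mact_rmult: "mact M x (rmult M\<^sub>F m a) =
    sweedler (comult (twist_hopf H F) x) (\<lambda>u v. rmult M\<^sub>F (mact M u m) (aact A v a))"
  using twist_comult_sweedler[of "mscale M" "\<lambda>x y. rmult M (mact M x m) (aact A y a)" x]
  by (simp add: linear_intros M.act_sweedler mact_rmult A.act_mult M.act_mult sweedler_swap[of "comult (twist_hopf H F) _" G])

lemma twist_lmult_bilinear: "k_bilinear (ascale A) (mscale M) (mscale M) (lmult M\<^sub>F)"
  by (rule k_bilinearI) (simp_all add: linear_intros)

lemma twist_rmult_bilinear: "k_bilinear (mscale M) (ascale A) (mscale M) (rmult M\<^sub>F)"
  by (rule k_bilinearI) (simp_all add: linear_intros)

lemma twist_bimodule: "equivariant_braided_symmetric_bimodule (twist_hopf H F) (twist_R H F R) A\<^sub>F M\<^sub>F"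
proof (intro equivariant_braided_symmetric_bimodule.intro equivariant_braided_symmetric_bimodule_axioms.intro)
  interpret twist: hopf_algebra "twist_hopf H F" by (rule twist_hopf_algebra)
  show "braided_commutative_module_algebra (twist_hopf H F) (twist_R H F R) A\<^sub>F"
    by (rule twist_braided_algebra)
  show "k_bilinear (ascale A\<^sub>F) (mscale M\<^sub>F) (mscale M\<^sub>F) (lmult M\<^sub>F)"
    "k_bilinear (mscale M\<^sub>F) (ascale A\<^sub>F) (mscale M\<^sub>F) (rmult M\<^sub>F)"
    using twist_lmult_bilinear twist_rmult_bilinear by simp_all
  fix a b :: 'a and m :: 'm and x :: 'h
  show "lmult M\<^sub>F (amult A\<^sub>F a b) m = lmult M\<^sub>F a (lmult M\<^sub>F b m)"
    using cocycle_sweedler[of "mscale M" "\<lambda>x y z. lmult M (amult A (aact A x a) (aact A y b)) (mact M z m)"]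
    by (simp add: linear_intros amult_sweedler lmult_sweedler A.act_sweedler M.act_sweedler aact_mult mact_lmult
      A.act_mult M.act_mult lmult_mult)
  show "rmult M\<^sub>F m (amult A\<^sub>F a b) = rmult M\<^sub>F (rmult M\<^sub>F m a) b"
    using cocycle_sweedler[of "mscale M" "\<lambda>x y z. rmult M (rmult M (mact M x m) (aact A y a)) (aact A z b)"]
    by (simp add: linear_intros amult_sweedler rmult_sweedler A.act_sweedler M.act_sweedler aact_mult mact_rmult
      A.act_mult M.act_mult rmult_mult)
  show "rmult M\<^sub>F (lmult M\<^sub>F a m) b = lmult M\<^sub>F a (rmult M\<^sub>F m b)"
    using cocycle_sweedler[of "mscale M" "\<lambda>x y z. rmult M (lmult M (aact A x a) (mact M y m)) (aact A z b)"]
    by (simp add: linear_intros lmult_sweedler rmult_sweedler A.act_sweedler M.act_sweedler mact_lmult mact_rmult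
      A.act_mult M.act_mult lmult_rmult)
  show "lmult M\<^sub>F (aone A\<^sub>F) m = m" "rmult M\<^sub>F m (aone A\<^sub>F) = m"
    using counit_G_sweedler[of "mscale M" "\<lambda>h. mact M h m"]
    by (simp_all add: linear_intros aact_one lmult_one rmult_one)
  show "left_module (twist_hopf H F) (mscale M\<^sub>F) (mact M\<^sub>F)"
    by (simp add: mact_module)
  show "mact M\<^sub>F x (rmult M\<^sub>F (lmult M\<^sub>F a m) b) =
      sweedler3 (comult_id (twist_hopf H F) (comult (twist_hopf H F) x))
        (\<lambda>u v w. rmult M\<^sub>F (lmult M\<^sub>F (aact A\<^sub>F u a) (mact M\<^sub>F v m)) (aact A\<^sub>F w b))"
  proof -
    \<comment> \<open>The twisted products stay folded as bilinear maps, so the two-sided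
      equivariance is the composite of the one-sided ones, without another use of the cocycle
      identity.\<close>
    note [linear_intros] = bilinear_left[OF twist_lmult_bilinear] bilinear_right[OF twist_lmult_bilinear]
      bilinear_left[OF twist_rmult_bilinear] bilinear_right[OF twist_rmult_bilinear]
    note sw = bilinear_sweedler_left[OF twist_rmult_bilinear]
    show ?thesis
      by (simp add: twist_mact_rmult twist_mact_lmult sw sweedler3_comult_id[where sB = "mscale M"] linear_intros
        del: twist_bimodule_simps(3,4))
  qed
  show "rmult M\<^sub>F m a = sweedler (inv2 (hscale (twist_hopf H F)) (twist_R H F R))
      (\<lambda>u v. lmult M\<^sub>F (aact A\<^sub>F u a) (mact M\<^sub>F v m))"
    using twist_R_sweedler[of "mscale M" "\<lambda>x y. lmult M (aact A x a) (mact M y m)"]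
    by (simp add: linear_intros A.act_mult M.act_mult braided_symmetric[of "mact M _ m"]
      sweedler_swap[of "inv2 _ (twist_R H F R)" G] sweedler_swap[of R' G])
qed

end

section \<open>Braided vector fields\<close>

context module_algebra
begin

abbreviation "ad \<equiv> adjoint_action H A"
abbreviation "linear_map X \<equiv> module_hom (ascale A) (ascale A) X"

lemma linear_map_apply:
  "linear_map X \<Longrightarrow> module_hom s' (ascale A) g \<Longrightarrow> module_hom s' (ascale A) (\<lambda>b. X (g b))"
  by (rule module_hom_compose)

lemma linear_ad_apply [linear_intros]:
  assumes "linear_map X" "module_hom s' (ascale A) g"
  shows "module_hom s' (ascale A) (\<lambda>b. ad x X (g b))"
  unfolding adjoint_action_def
  by (simp add: linear_intros linear_map_apply[OF assms(1)] assms(2))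

lemma linear_ad_left [linear_intros]:
  assumes "linear_map X" "module_hom s' (hscale H) g"
  shows "module_hom s' (ascale A) (\<lambda>x. ad (g x) X a)"
  unfolding adjoint_action_def
  by (simp add: linear_intros linear_map_apply[OF assms(1)] assms(2))

lemma linear_ad [linear_intros]: "linear_map X \<Longrightarrow> linear_map (ad x X)"
  using linear_ad_apply[of X "ascale A" "\<lambda>b. b"] by (simp add: linear_intros)

text \<open>Expanding the adjoint action gives x1 X(S(x2) x3 a), where S(x2) x3 contracts to a
  counit.\<close>

lemma aact_apply:
  assumes X: "linear_map X"
  shows "aact A x (X a) = sweedler (comult H x) (\<lambda>u v. ad u X (aact A v a))"
proof -
  note [linear_intros] = linear_map_apply[OF X]
  have 1: "sweedler (comult H x) (\<lambda>u v. aact A p (X (aact A (antipode H u) (aact A v a)))) =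
      ascale A (counit H x) (aact A p (X a))" for x p
    using antipode_left_sweedler[of "ascale A" "\<lambda>h. aact A p (X (aact A h a))" x]
    by (simp add: linear_intros A.act_mult)
  have "sweedler (comult H x) (\<lambda>u v. ad u X (aact A v a)) =
      sweedler (comult H x) (\<lambda>u v. sweedler (comult H u) (\<lambda>p q. aact A p (X (aact A (antipode H q) (aact A v a)))))"
    by (simp add: adjoint_action_def)
  also have "\<dots> = sweedler (comult H x) (\<lambda>u v. ascale A (counit H v) (aact A u (X a)))"
    by (simp add: coassoc_sweedler[where sB = "ascale A"] linear_intros 1)
  also have "\<dots> = aact A x (X a)"
    by (rule counit_right_sweedler) (simp add: linear_intros)
  finally show ?thesis ..
qed

text \<open>The equivariance of the evaluation map determines the adjoint action.\<close>

lemma ad_eqI: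
  assumes X: "linear_map X" and Y: "k_bilinear (hscale H) (ascale A) (ascale A) Y"
    and eq: "\<And>x a. aact A x (X a) = sweedler (comult H x) (\<lambda>u v. Y u (aact A v a))"
  shows "ad x X = Y x"
proof
  fix a
  note [linear_intros] = bilinear_left[OF Y] bilinear_right[OF Y]
  have "ad x X a - Y x a = 0"
    by (rule A.bilinear_cancel[where sB = "ascale A" and g = "\<lambda>x a. ad x X a - Y x a"])
      (simp_all add: X linear_intros sweedler_diff eq flip: aact_apply[OF X])
  then show "ad x X a = Y x a"
    by simp
qed

lemma ad_one [simp]:
  assumes "linear_map X"
  shows "ad 1 X = X"
  by (rule ext) (simp add: adjoint_action_def comult_one sweedler_one2[where sB = "ascale A"]
    linear_intros linear_map_apply[OF assms])

text \<open>Through \<open>ad_eqI\<close> only the equivariance of evaluation at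
  \<open>ad y X\<close> has to be checked. After both coproducts are expanded, an antipode meets its
  left neighbour and contracts.\<close>

lemma ad_ad:
  assumes X: "linear_map X"
  shows "ad x (ad y X) = ad (x * y) X"
proof (rule ad_eqI)
  show "linear_map (ad y X)"
    by (simp add: X linear_intros)
  show "k_bilinear (hscale H) (ascale A) (ascale A) (\<lambda>x. ad (x * y) X)"
    by (simp add: X linear_intros)
  note [linear_intros] = linear_map_apply[OF X]
  fix x a
  have 1: "sweedler (comult H y) (\<lambda>u v. ad p X (aact A q (aact A u (aact A (antipode H v) a)))) =
      ascale A (counit H y) (ad p X (aact A q a))" for y p q
    using antipode_right_sweedler[of "ascale A" "\<lambda>h. ad p X (aact A q (aact A h a))" y]
    by (simp add: X linear_intros A.act_mult)
  have "aact A x (ad y X a) = sweedler (comult H y) (\<lambda>p q. aact A (x * p) (X (aact A (antipode H q) a)))"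
    by (simp add: adjoint_action_def A.act_sweedler A.act_mult)
  also have "\<dots> = sweedler (comult H x) (\<lambda>u v. sweedler (comult H y) (\<lambda>r q. sweedler (comult H r)
      (\<lambda>p s. ad (u * p) X (aact A v (aact A s (aact A (antipode H q) a))))))"
    by (simp add: aact_apply[OF X] X comult_mult_sweedler[where sB = "ascale A"] linear_intros A.act_mult
      sweedler_swap[of "comult H y"])
  also have "\<dots> = sweedler (comult H x) (\<lambda>u v. sweedler (comult H y)
      (\<lambda>p r. ascale A (counit H r) (ad (u * p) X (aact A v a))))"
    by (simp add: X coassoc_sweedler[where sB = "ascale A"] linear_intros 1)
  also have "\<dots> = sweedler (comult H x) (\<lambda>u v. ad (u * y) X (aact A v a))"
    by (simp add: X counit_right_sweedler[where sB = "ascale A"] linear_intros)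
  finally show "aact A x (ad y X a) = sweedler (comult H x) (\<lambda>u v. ad (u * y) X (aact A v a))" .
qed

lemma ad_lmult:
  assumes X: "linear_map X"
  shows "ad x (\<lambda>b. amult A a (X b)) =
    (\<lambda>b. sweedler (comult H x) (\<lambda>u v. amult A (aact A u a) (ad v X b)))"
proof (rule ad_eqI)
  note [linear_intros] = linear_map_apply[OF X]
  show "linear_map (\<lambda>b. amult A a (X b))"
    by (simp add: linear_intros)
  show "k_bilinear (hscale H) (ascale A) (ascale A)
      (\<lambda>x b. sweedler (comult H x) (\<lambda>u v. amult A (aact A u a) (ad v X b)))"
    by (simp add: X linear_intros)
  show "aact A x (amult A a (X b)) = sweedler (comult H x) (\<lambda>u v. sweedler (comult H u)
      (\<lambda>p q. amult A (aact A p a) (ad q X (aact A v b))))" for x b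
    by (simp add: X aact_mult aact_apply[OF X] amult_sweedler coassoc_sweedler[where sB = "ascale A"] linear_intros)
qed

lemma ad_add: "ad x (\<lambda>a. X a + Y a) = (\<lambda>a. ad x X a + ad x Y a)"
  by (rule ext) (simp add: adjoint_action_def sweedler_add A.act_add)

lemma ad_sweedler: "ad x (\<lambda>b. sweedler t (\<lambda>u v. Z u v b)) = (\<lambda>b. sweedler t (\<lambda>u v. ad x (Z u v) b))"
  by (rule ext) (simp add: adjoint_action_def A.act_sweedler sweedler_swap[of "comult H x"])

lemma ad_scale: "ad x (\<lambda>a. ascale A c (X a)) = (\<lambda>a. ascale A c (ad x X a))"
  by (rule ext) (simp add: adjoint_action_def A.scalar_sweedler)

end

section \<open>Closure properties of braided derivations\<close>

context braided_commutative_module_algebra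
begin

abbreviation "Der \<equiv> braided_vector_fields H R A"

lemma Der_linear [linear_intros]: "X \<in> Der \<Longrightarrow> linear_map X"
  by (simp add: braided_vector_fields_def)

lemma Der_leibniz: "X \<in> Der \<Longrightarrow> X (amult A a b) =
    amult A (X a) b + sweedler R' (\<lambda>u v. amult A (aact A u a) (ad v X b))"
  by (simp add: braided_vector_fields_def)

lemma DerI:
  assumes "linear_map X"
    and "\<And>a b. X (amult A a b) = amult A (X a) b + sweedler R' (\<lambda>u v. amult A (aact A u a) (ad v X b))"
  shows "X \<in> Der"
  using assms by (simp add: braided_vector_fields_def)

text \<open>\<open>W\<close> is the defect of the Leibniz rule for the transformed field. Acting
  with x on the Leibniz rule of X gives W(x1, x2 a, x3 b) = 0 in the summed sense, once
  quasi-commutativity has moved the inverse of R to the left of the coproduct. Two cancellations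
  then remove the actions on b and on a.\<close>

lemma Der_ad:
  assumes X: "X \<in> Der"
  shows "ad x X \<in> Der"
proof (rule DerI)
  show "linear_map (ad x X)"
    by (simp add: X linear_intros)
  note [linear_intros] = Der_linear[OF X]
  define W where "W x a b = ad x X (amult A a b) - (amult A (ad x X a) b +
    sweedler R' (\<lambda>u v. amult A (aact A u a) (ad (v * x) X b)))" for x a b
  have W [linear_intros]: "module_hom s' (hscale H) h \<Longrightarrow> module_hom s' (ascale A) (\<lambda>x. W (h x) a b)"
    "module_hom s' (ascale A) g \<Longrightarrow> module_hom s' (ascale A) (\<lambda>a. W x (g a) b)"
    "module_hom s' (ascale A) g \<Longrightarrow> module_hom s' (ascale A) (\<lambda>b. W x a (g b))"
    for s' :: "'k \<Rightarrow> 'x::ab_group_add \<Rightarrow> 'x" and h g x a b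
    unfolding W_def by (simp_all add: linear_intros)
  have zero: "sweedler (comult H x) (\<lambda>u v. sweedler (comult H u) (\<lambda>p q. W p (aact A q a) (aact A v b))) = 0" for x a b
  proof -
    have "sweedler (comult H x) (\<lambda>u v. sweedler (comult H u) (\<lambda>p q. ad p X (amult A (aact A q a) (aact A v b)))) =
        aact A x (X (amult A a b))"
      by (simp add: coassoc_sweedler[where sB = "ascale A"] linear_intros aact_apply[OF Der_linear[OF X]] aact_mult
        module_hom_sweedler[OF linear_ad[OF Der_linear[OF X]]])
    also have "\<dots> = sweedler (comult H x) (\<lambda>u v. amult A (aact A u (X a)) (aact A v b)) +
       sweedler (comult H x) (\<lambda>u v. sweedler R' (\<lambda>r t. amult A (aact A (u * r) a) (aact A v (ad t X b))))"
      by (simp add: Der_leibniz[OF X] A.act_add A.act_sweedler aact_mult A.act_mult sweedler_swap[of R'])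
    also have "\<dots> = sweedler (comult H x) (\<lambda>u v. sweedler (comult H u) (\<lambda>p q. amult A (ad p X (aact A q a)) (aact A v b))) +
       sweedler (comult H x) (\<lambda>u v. sweedler (comult H v) (\<lambda>p q.
         sweedler R' (\<lambda>r t. amult A (aact A (u * r) a) (ad (p * t) X (aact A q b)))))"
      by (simp add: aact_apply linear_intros ad_ad amult_sweedler sweedler_swap[of R'])
    also have "\<dots> = sweedler (comult H x) (\<lambda>u v. sweedler (comult H u) (\<lambda>p q. amult A (ad p X (aact A q a)) (aact A v b))) +
       sweedler (comult H x) (\<lambda>u v. sweedler (comult H u) (\<lambda>p q.
         sweedler R' (\<lambda>r t. amult A (aact A (r * q) a) (ad (t * p) X (aact A v b)))))"
      using R'_comult_sweedler[of "ascale A" "\<lambda>x y. amult A (aact A x a) (ad y X (aact A _ b))"]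
      by (simp add: coassoc_sweedler[where sB = "ascale A"] linear_intros)
    finally show ?thesis
      by (simp add: W_def sweedler_diff sweedler_add A.act_mult)
  qed
  fix a b
  have "sweedler (comult H x) (\<lambda>u v. W u (aact A v a) b) = 0" for x a b
    by (rule A.bilinear_cancel[where sB = "ascale A" and g = "\<lambda>x b. sweedler (comult H x) (\<lambda>u v. W u (aact A v a) b)"])
      (simp_all add: linear_intros zero)
  then have "W x a b = 0"
    by (intro A.bilinear_cancel[where sB = "ascale A" and g = "\<lambda>x a. W x a b"]) (simp_all add: linear_intros)
  then show "ad x X (amult A a b) = amult A (ad x X a) b +
      sweedler R' (\<lambda>u v. amult A (aact A u a) (ad v (ad x X) b))"
    by (simp add: W_def ad_ad linear_intros)
qed

text \<open>Moving a past the first argument by braided commutativity produces a second inverse of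
  R; the hexagon merges the two into a single braiding of that argument with the whole field
  aX.\<close>

lemma Der_lmult:
  assumes X: "X \<in> Der"
  shows "(\<lambda>b. amult A a (X b)) \<in> Der"
proof (rule DerI)
  note [linear_intros] = Der_linear[OF X] linear_map_apply[OF Der_linear[OF X]]
  show "linear_map (\<lambda>b. amult A a (X b))"
    by (simp add: linear_intros)
  show "amult A a (X (amult A b c)) = amult A (amult A a (X b)) c +
      sweedler R' (\<lambda>u v. amult A (aact A u b) (ad v (\<lambda>b. amult A a (X b)) c))" for b c
  proof -
    have "amult A a (amult A b' c') = sweedler R' (\<lambda>p q. amult A (aact A p b') (amult A (aact A q a) c'))" for b' c'
      unfolding amult_assoc[symmetric, of a] unfolding braided_commutative[of a]
      by (simp add: amult_sweedler amult_assoc)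
    then show ?thesis
      using R'_id_comult_sweedler[of "ascale A" "\<lambda>x y z. amult A (aact A x b) (amult A (aact A y a) (ad z X c))"]
      by (simp add: Der_leibniz[OF X] linear_intros ad_lmult amult_sweedler A.act_mult
        amult_assoc amult_add) (rule sweedler_swap)
  qed
qed

lemma Der_add:
  assumes "X \<in> Der" "Y \<in> Der"
  shows "(\<lambda>a. X a + Y a) \<in> Der"
  using Der_linear[OF assms(1)] Der_linear[OF assms(2)]
  by (intro DerI linear_add) (simp_all add: Der_leibniz assms ad_add amult_add sweedler_add add_ac)

lemma Der_scale:
  assumes "X \<in> Der"
  shows "(\<lambda>a. ascale A c (X a)) \<in> Der"
  using Der_linear[OF assms] module.scale_right_distrib[OF A.module_sN]
  by (intro DerI) (simp_all add: linear_intros Der_leibniz assms ad_scale A.scalar_sweedler)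

lemma Der_zero: "(\<lambda>a. 0) \<in> Der"
proof (rule DerI)
  have "amult A 0 b = 0" "amult A b 0 = 0" "aact A x 0 = 0" for b x
    using amult_add[of 0 0] amult_add(2)[of _ 0 0] A.act_add[of _ 0 0] by simp_all
  then show "0 = amult A 0 b + sweedler R' (\<lambda>u v. amult A (aact A u a) (ad v (\<lambda>a. 0) b))" for a b
    by (simp add: adjoint_action_def)
qed (simp add: module_homI linear_intros module.scale_zero_right[OF A.module_sN])

lemma Der_sum_mset:
  assumes "\<And>p. Z p \<in> Der"
  shows "(\<lambda>a. \<Sum>p\<in>#w. Z p a) \<in> Der"
  by (induction w) (simp_all add: Der_zero Der_add assms)

lemma Der_sweedler: "(\<And>u v. Z u v \<in> Der) \<Longrightarrow> (\<lambda>a. sweedler t (\<lambda>u v. Z u v a)) \<in> Der"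
  unfolding sweedler_def case_prod_unfold by (rule Der_sum_mset)

end

section \<open>Twisting equivariant covariant derivatives\<close>

context equivariant_covariant_derivative
begin

lemma nabla_zero: "nabla (\<lambda>a. 0) m = 0"
  using nabla_scale[OF Der_zero, of 0] module.scale_zero_left[OF A.module_sN]
    module.scale_zero_left[OF M.module_sN] by simp

lemma nabla_sum_mset:
  assumes "\<And>p. Z p \<in> Der"
  shows "nabla (\<lambda>a. \<Sum>p\<in>#w. Z p a) m = (\<Sum>p\<in>#w. nabla (Z p) m)"
  by (induction w) (simp_all add: nabla_zero nabla_add Der_sum_mset assms)

text \<open>The derivative is constrained only on braided derivations, so additivity applies only
  when every partial sum is one. This is the purpose of the closure properties, down to the zero
  field for the empty sum.\<close>

lemma nabla_sweedler:
  "(\<And>u v. Z u v \<in> Der) \<Longrightarrow>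
    nabla (\<lambda>a. sweedler t (\<lambda>u v. Z u v a)) m = sweedler t (\<lambda>u v. nabla (Z u v) m)"
  unfolding sweedler_def case_prod_unfold by (rule nabla_sum_mset)

lemma nabla_sweedler_right:
  "X \<in> Der \<Longrightarrow> nabla X (sweedler t f) = sweedler t (\<lambda>u v. nabla X (f u v))"
  by (rule module_hom_sweedler[OF nabla_linear])

lemma linear_nabla_right:
  "X \<in> Der \<Longrightarrow> module_hom s' (mscale M) g \<Longrightarrow> module_hom s' (mscale M) (\<lambda>h. nabla X (g h))"
  by (rule module_hom_compose[OF nabla_linear])

lemma linear_nabla_ad_right [linear_intros]:
  "X \<in> Der \<Longrightarrow> module_hom s' (mscale M) g \<Longrightarrow> module_hom s' (mscale M) (\<lambda>h. nabla (ad x X) (g h))"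
  by (simp add: linear_nabla_right Der_ad)

lemma linear_nabla_ad_left [linear_intros]:
  assumes X: "X \<in> Der" and g: "module_hom s' (hscale H) g"
  shows "module_hom s' (mscale M) (\<lambda>h. nabla (ad (g h) X) m)"
proof (rule module_hom_compose[OF _ g])
  show "module_hom (hscale H) (mscale M) (\<lambda>h. nabla (ad h X) m)"
  proof (rule module_homI)
    interpret ad: module_hom "hscale H" "ascale A" "\<lambda>h. ad h X a" for a
      using linear_ad_left[OF Der_linear[OF X], of "hscale H" "\<lambda>h. h"] by (simp add: linear_intros)
    have "ad (x + y) X = (\<lambda>a. ad x X a + ad y X a)" for x y
      by (rule ext) (rule ad.add)
    then show "nabla (ad (x + y) X) m = nabla (ad x X) m + nabla (ad y X) m" for x y
      by (simp add: nabla_add Der_ad X)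
    have "ad (hscale H c x) X = (\<lambda>a. ascale A c (ad x X a))" for c x
      by (rule ext) (rule ad.scale)
    then show "nabla (ad (hscale H c x) X) m = mscale M c (nabla (ad x X) m)" for c x
      by (simp add: nabla_scale Der_ad X)
  qed (simp_all add: linear_intros)
qed

end

locale twisted_covariant_derivative = equivariant_covariant_derivative H R A M nabla + drinfeld_twist H F
  for H :: "('k::comm_ring_1, 'h::ring_1) hopf_data" and R
    and A :: "('k, 'h, 'a::ab_group_add) algebra_data"
    and M :: "('k, 'h, 'a, 'm::ab_group_add) bimodule_data" and nabla and F
begin

sublocale twisted_bimodule H R A M F ..

abbreviation "nabla\<^sub>F \<equiv> twist_nabla H F A M nabla"

lemma twist_nabla_linear: "X \<in> Der \<Longrightarrow> module_hom (mscale M) (mscale M) (nabla\<^sub>F X)"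
  by (simp add: twist_nabla_def[abs_def] linear_intros)

lemma twist_nabla_add:
  "X \<in> Der \<Longrightarrow> Y \<in> Der \<Longrightarrow> nabla\<^sub>F (\<lambda>a. X a + Y a) m = nabla\<^sub>F X m + nabla\<^sub>F Y m"
  by (simp add: twist_nabla_def ad_add nabla_add Der_ad sweedler_add)

lemma twist_nabla_scale:
  "X \<in> Der \<Longrightarrow> nabla\<^sub>F (\<lambda>a. ascale A c (X a)) m = mscale M c (nabla\<^sub>F X m)"
  by (simp add: twist_nabla_def ad_scale nabla_scale Der_ad M.scalar_sweedler)

lemma twist_nabla_equivariant:
  assumes X: "X \<in> Der"
  shows "mact M x (nabla\<^sub>F X m) =
    sweedler (comult (twist_hopf H F) x) (\<lambda>u v. nabla\<^sub>F (ad u X) (mact M v m))"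
  using twist_comult_sweedler[of "mscale M" "\<lambda>x y. nabla (ad x X) (mact M y m)" x]
  by (simp add: twist_nabla_def linear_intros X Der_ad nabla_equivariant ad_ad M.act_sweedler M.act_mult
    sweedler_swap[of "comult (twist_hopf H F) _" G])

text \<open>The field is a times X in the twisted module of vector fields, written out.\<close>

lemma Der_twist_lmult:
  "X \<in> Der \<Longrightarrow> (\<lambda>b. sweedler G (\<lambda>u v. amult A (aact A u a) (ad v X b))) \<in> Der"
  by (intro Der_sweedler Der_lmult Der_ad)

lemma twist_nabla_lmult:
  assumes X: "X \<in> Der"
  shows "nabla\<^sub>F (\<lambda>b. sweedler G (\<lambda>u v. amult A (aact A u a) (ad v X b))) m = lmult M\<^sub>F a (nabla\<^sub>F X m)"
  using cocycle_sweedler[of "mscale M" "\<lambda>x y z. lmult M (aact A x a) (nabla (ad y X) (mact M z m))"]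
  by (simp add: twist_nabla_def X linear_intros Der_sweedler Der_lmult Der_ad ad_sweedler ad_lmult ad_ad
    nabla_sweedler nabla_lmult nabla_equivariant A.act_mult M.act_mult M.act_sweedler lmult_sweedler)

lemma twist_nabla_leibniz:
  assumes X: "X \<in> Der"
  shows "nabla\<^sub>F X (lmult M\<^sub>F a m) = lmult M\<^sub>F (twist_vector_field H F A X a) m +
    sweedler (inv2 (hscale H) (twist_R H F R)) (\<lambda>u v. lmult M\<^sub>F (aact A u a) (nabla\<^sub>F (ad v X) m))"
proof -
  note [linear_intros] = Der_linear[OF X]
  define g where "g x y z = lmult M (aact A x a) (nabla (ad y X) (mact M z m))" for x y z
  have [linear_intros]:
    "module_hom s' (hscale H) h \<Longrightarrow> module_hom s' (mscale M) (\<lambda>x. g (h x) y z)"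
    "module_hom s' (hscale H) h \<Longrightarrow> module_hom s' (mscale M) (\<lambda>y. g x (h y) z)"
    "module_hom s' (hscale H) h \<Longrightarrow> module_hom s' (mscale M) (\<lambda>z. g x y (h z))"
    for s' :: "'k \<Rightarrow> 'x::ab_group_add \<Rightarrow> 'x" and h x y z
    unfolding g_def by (simp_all add: linear_intros X)
  \<comment> \<open>The Leibniz rule is applied under the sum over G, after the action on the
    twisted product has been distributed. The first sum differentiates a, the second carries the
    braiding.\<close>
  have "nabla\<^sub>F X (lmult M\<^sub>F a m) =
      sweedler G (\<lambda>u v. sweedler G (\<lambda>p q. sweedler (comult H v) (\<lambda>x y.
        lmult M (ad u X (aact A (x * p) a)) (mact M (y * q) m)))) +
      sweedler G (\<lambda>u v. sweedler G (\<lambda>p q. sweedler (comult H v) (\<lambda>x y.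
        sweedler R' (\<lambda>r t. g (r * (x * p)) (t * u) (y * q)))))"
    by (simp add: twist_nabla_def X linear_intros Der_ad M.act_sweedler mact_lmult nabla_sweedler_right
      nabla_leibniz ad_ad A.act_mult M.act_mult sweedler_add g_def)
  \<comment> \<open>Here the cocycle identity moves the coproduct onto the pair formed by X and a,
    where equivariance of evaluation reassembles the twisted field.\<close>
  also have "sweedler G (\<lambda>u v. sweedler G (\<lambda>p q. sweedler (comult H v) (\<lambda>x y.
        lmult M (ad u X (aact A (x * p) a)) (mact M (y * q) m)))) =
      lmult M\<^sub>F (twist_vector_field H F A X a) m"
    using cocycle_sweedler[of "mscale M" "\<lambda>x y z. lmult M (ad x X (aact A y a)) (mact M z m)"]
    by (simp add: twist_vector_field_def A.act_sweedler aact_apply linear_intros ad_ad lmult_sweedler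
      A.act_mult)
  \<comment> \<open>The inverse of R braids a with X, but the coproduct still splits a from m. The
    cocycle identity moves it to the legs of X and a, so that R and the coproduct can be
    exchanged.\<close>
  also have "sweedler G (\<lambda>u v. sweedler G (\<lambda>p q. sweedler (comult H v) (\<lambda>x y.
        sweedler R' (\<lambda>r t. g (r * (x * p)) (t * u) (y * q))))) =
      sweedler G (\<lambda>u v. sweedler G (\<lambda>p q. sweedler (comult H u) (\<lambda>x y.
        sweedler R' (\<lambda>r t. g (r * (y * q)) (t * (x * p)) v))))"
    by (rule cocycle_sweedler[where sB = "mscale M" and f = "\<lambda>x y z. sweedler R' (\<lambda>r t. g (r * y) (t * x) z)", symmetric])
      (simp add: linear_intros)
  also have "\<dots> = sweedler G (\<lambda>u v. sweedler G (\<lambda>p q. sweedler (comult H u) (\<lambda>x y.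
        sweedler R' (\<lambda>r t. g (x * (r * q)) (y * (t * p)) v))))"
    using R'_comult_sweedler[of "mscale M" "\<lambda>x y. g (x * _) (y * _) _"]
    by (simp add: linear_intros mult.assoc)
  also have "\<dots> = sweedler G (\<lambda>u v. sweedler (comult H u) (\<lambda>x y.
       sweedler R' (\<lambda>r t. sweedler G (\<lambda>p q. g (x * (r * q)) (y * (t * p)) v))))"
    by (simp add: sweedler_swap[of "comult H _" G] sweedler_swap[of R' G])
  \<comment> \<open>Now the inverse of R stands next to the flipped inverse twist, and the two are
    replaced by the inverse twist and the inverse of R_F.\<close>
  also have "\<dots> = sweedler G (\<lambda>u v. sweedler (comult H u) (\<lambda>x y. sweedler G (\<lambda>p q.
       sweedler (inv2 (hscale H) (twist_R H F R)) (\<lambda>c d. g (x * (p * c)) (y * (q * d)) v))))"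
    using twist_R_sweedler[of "mscale M" "\<lambda>x y. g (_ * x) (_ * y) _"]
    by (simp add: linear_intros)
  also have "\<dots> = sweedler G (\<lambda>u v. sweedler G (\<lambda>p q. sweedler (comult H u) (\<lambda>x y.
       sweedler (inv2 (hscale H) (twist_R H F R)) (\<lambda>c d. g (x * p * c) (y * q * d) v))))"
    by (simp add: sweedler_swap[of "comult H _" G] mult.assoc)
  \<comment> \<open>The cocycle identity in the opposite direction: the coproduct returns to the
    legs of X and m, as equivariance of the inner derivative on the right-hand side demands.\<close>
  also have "\<dots> = sweedler G (\<lambda>u v. sweedler G (\<lambda>p q. sweedler (comult H v) (\<lambda>x y.
       sweedler (inv2 (hscale H) (twist_R H F R)) (\<lambda>c d. g (u * c) (x * p * d) (y * q)))))"
    by (rule cocycle_sweedler[where sB = "mscale M" and f = "\<lambda>x y z.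
      sweedler (inv2 (hscale H) (twist_R H F R)) (\<lambda>c d. g (x * c) (y * d) z)"])
      (simp add: linear_intros)
  also have "\<dots> = sweedler (inv2 (hscale H) (twist_R H F R)) (\<lambda>u v. lmult M\<^sub>F (aact A u a) (nabla\<^sub>F (ad v X) m))"
    by (simp add: twist_nabla_def X Der_ad linear_intros M.act_sweedler nabla_equivariant ad_ad lmult_sweedler
      A.act_mult M.act_mult g_def mult.assoc sweedler_swap[of "inv2 (hscale H) (twist_R H F R)" G]
      sweedler_swap[of "inv2 (hscale H) (twist_R H F R)" "comult H _"])
  finally show ?thesis .
qed

end

section \<open>The isomorphism of vector fields\<close>

context braided_commutative_module_algebra
begin

text \<open>
  Evaluation of vector fields is an equivariant covariant derivative on the algebra itself. Hence
  \<open>X \<mapsto> X\<^sup>F\<close> is a special case of the twist of covariant derivatives.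
\<close>

abbreviation "regular \<equiv> \<lparr>mscale = ascale A, lmult = amult A, rmult = amult A, mact = aact A\<rparr>"

lemma regular_bimodule: "equivariant_braided_symmetric_bimodule H R A regular"
proof (intro equivariant_braided_symmetric_bimodule.intro equivariant_braided_symmetric_bimodule_axioms.intro)
  show "braided_commutative_module_algebra H R A"
    by (rule braided_commutative_module_algebra_axioms)
  show "mact regular x (rmult regular (lmult regular a m) b) = sweedler3 (comult_id H (comult H x))
      (\<lambda>u v w. rmult regular (lmult regular (aact A u a) (mact regular v m)) (aact A w b))" for x a m b
    by (simp add: aact_mult amult_sweedler sweedler3_comult_id[where sB = "ascale A"] linear_intros)
qed (simp_all add: amult_bilinear amult_assoc aone_left aone_right aact_module flip: braided_commutative)

lemma evaluation_covariant_derivative: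
  "equivariant_covariant_derivative H R A regular (\<lambda>X. X)"
proof (intro equivariant_covariant_derivative.intro equivariant_covariant_derivative_axioms.intro)
  show "equivariant_braided_symmetric_bimodule H R A regular"
    by (rule regular_bimodule)
qed (simp_all add: Der_linear aact_apply Der_leibniz)

end

context twisted_braided_algebra
begin

abbreviation "twist_field \<equiv> twist_vector_field H F A"

lemma twisted_evaluation: "twisted_covariant_derivative H R A regular (\<lambda>X. X) F"
  by (intro twisted_covariant_derivative.intro evaluation_covariant_derivative drinfeld_twist_axioms)

lemma twist_nabla_evaluation: "twist_nabla H F A regular (\<lambda>X. X) = twist_field"
  by (intro ext) (simp add: twist_nabla_def twist_vector_field_def)

lemma twist_bimodule_regular: "lmult (twist_bimodule H F A regular) = amult A\<^sub>F"
  by (intro ext) simp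

lemma twist_field_linear: "X \<in> Der \<Longrightarrow> module_hom (ascale A) (ascale A) (twist_field X)"
  using twisted_covariant_derivative.twist_nabla_linear[OF twisted_evaluation]
  by (simp add: twist_nabla_evaluation)

lemma twist_field_add:
  "X \<in> Der \<Longrightarrow> Y \<in> Der \<Longrightarrow> twist_field (\<lambda>a. X a + Y a) = (\<lambda>a. twist_field X a + twist_field Y a)"
  using twisted_covariant_derivative.twist_nabla_add[OF twisted_evaluation]
  by (simp add: twist_nabla_evaluation fun_eq_iff)

lemma twist_field_scale:
  "X \<in> Der \<Longrightarrow> twist_field (\<lambda>a. ascale A c (X a)) = (\<lambda>a. ascale A c (twist_field X a))"
  using twisted_covariant_derivative.twist_nabla_scale[OF twisted_evaluation]
  by (simp add: twist_nabla_evaluation fun_eq_iff)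

lemma twist_field_lmult:
  assumes "X \<in> Der"
  shows "twist_field (\<lambda>b. sweedler G (\<lambda>u v. amult A (aact A u a) (ad v X b))) = (\<lambda>b. amult A\<^sub>F a (twist_field X b))"
  using twisted_covariant_derivative.twist_nabla_lmult[OF twisted_evaluation assms]
  unfolding twist_nabla_evaluation twist_bimodule_regular by (intro ext)

text \<open>\<open>ad_eqI\<close> in the twisted algebra reduces the claim to equivariance of the
  twisted evaluation, so the twisted antipode is never unfolded.\<close>

lemma adjoint_action_twist:
  assumes X: "X \<in> Der"
  shows "adjoint_action (twist_hopf H F) A\<^sub>F x (twist_field X) = twist_field (ad x X)"
proof -
  interpret twist: module_algebra "twist_hopf H F" A\<^sub>F
    by (rule twist_module_algebra)
  show ?thesis
  proof (rule twist.ad_eqI)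
    show "module_hom (ascale A\<^sub>F) (ascale A\<^sub>F) (twist_field X)"
      by (simp add: twist_field_linear X)
    show "k_bilinear (hscale (twist_hopf H F)) (ascale A\<^sub>F) (ascale A\<^sub>F) (\<lambda>x. twist_field (ad x X))"
      unfolding twist_vector_field_def using Der_linear[OF X]
      by (simp add: linear_intros ad_ad)
    show "aact A\<^sub>F x (twist_field X a) =
        sweedler (comult (twist_hopf H F) x) (\<lambda>u v. twist_field (ad u X) (aact A\<^sub>F v a))" for x a
      using twisted_covariant_derivative.twist_nabla_equivariant[OF twisted_evaluation X]
      by (simp add: twist_nabla_evaluation)
  qed
qed

lemma twist_field_leibniz:
  assumes X: "X \<in> Der"
  shows "twist_field X (amult A\<^sub>F a b) = amult A\<^sub>F (twist_field X a) b +
    sweedler (inv2 (hscale H) (twist_R H F R)) (\<lambda>u v. amult A\<^sub>F (aact A u a) (twist_field (ad v X) b))"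
  using twisted_covariant_derivative.twist_nabla_leibniz[OF twisted_evaluation X]
  unfolding twist_nabla_evaluation twist_bimodule_regular .

lemma twist_field_in:
  assumes X: "X \<in> Der"
  shows "twist_field X \<in> braided_vector_fields (twist_hopf H F) (twist_R H F R) A\<^sub>F"
  using X by (simp add: braided_vector_fields_def[of "twist_hopf H F"] twist_field_linear twist_field_leibniz
    adjoint_action_twist del: twist_algebra_simps(4))

section \<open>The inverse of the identification of vector fields\<close>

lemma inverse_twisted_algebra:
  "twisted_braided_algebra (twist_hopf H F) (twist_R H F R) A\<^sub>F G"
  by (intro twisted_braided_algebra.intro twist_braided_algebra inverse_twist)

text \<open>Twisting by G sums over its inverse F, so the double twist is a sum over G F = 1
  \<otimes> 1. The same word governs \<open>twist_field_inverse\<close>.\<close>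

lemma twist_algebra_inverse: "twist_algebra (twist_hopf H F) G A\<^sub>F = A"
proof -
  have "amult (twist_algebra (twist_hopf H F) G A\<^sub>F) a b = amult A a b" for a b
  proof -
    have "sweedler (G \<bullet> F) (\<lambda>u v. amult A (aact A u a) (aact A v b)) = amult A a b"
      by (simp add: sweedler_one2[where sB = "ascale A"] linear_intros)
    then show ?thesis
      by (simp add: inv2_G sweedler_mult2[where sB = "ascale A"] linear_intros A.act_mult sweedler_swap[of F]
        del: GF)
  qed
  then show ?thesis
    by (intro algebra_data.equality) (simp_all add: fun_eq_iff del: twist_algebra_simps(4))
qed

lemma twist_field_inverse:
  assumes X: "X \<in> Der"
  shows "twist_vector_field (twist_hopf H F) G A\<^sub>F (twist_field X) = X"
proof
  fix a
  have "sweedler (G \<bullet> F) (\<lambda>u v. ad u X (aact A v a)) = X a"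
    using Der_linear[OF X] by (simp add: sweedler_one2[where sB = "ascale A"] linear_intros)
  then show "twist_vector_field (twist_hopf H F) G A\<^sub>F (twist_field X) a = X a"
    unfolding twist_vector_field_def[of "twist_hopf H F"] adjoint_action_twist[OF X]
    using Der_linear[OF X]
    by (simp add: twist_vector_field_def inv2_G sweedler_mult2[where sB = "ascale A"] linear_intros A.act_mult
      ad_ad sweedler_swap[of F] del: GF)
qed

lemma twist_field_bij: "bij_betw twist_field Der (braided_vector_fields (twist_hopf H F) (twist_R H F R) A\<^sub>F)"
proof -
  interpret inverse: twisted_braided_algebra "twist_hopf H F" "twist_R H F R" "A\<^sub>F" G
    by (rule inverse_twisted_algebra)
  let ?f = "twist_vector_field (twist_hopf H F) G A\<^sub>F"
  show ?thesis
  proof (rule bij_betw_byWitness[where f' = ?f])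
    show "\<forall>X\<in>Der. ?f (twist_field X) = X"
      by (simp add: twist_field_inverse)
    \<comment> \<open>The other composite is the same lemma for the inverse twist; the equalities of
      records translate its statement back.\<close>
    show "\<forall>Y\<in>braided_vector_fields (twist_hopf H F) (twist_R H F R) A\<^sub>F. twist_field (?f Y) = Y"
      using inverse.twist_field_inverse by (simp add: inv2_G twist_hopf_inverse twist_algebra_inverse)
    show "twist_field ` Der \<subseteq> braided_vector_fields (twist_hopf H F) (twist_R H F R) A\<^sub>F"
      by (auto intro: twist_field_in)
    show "?f ` braided_vector_fields (twist_hopf H F) (twist_R H F R) A\<^sub>F \<subseteq> Der"
      using inverse.twist_field_in
      by (auto simp: inv2_G twist_hopf_inverse twist_algebra_inverse twist_R_inverse_twist)
  qed
qed

end

text \<open>The derivative takes fields of the twisted algebra, so \<open>inv_into\<close> realises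
  the identification. By bijectivity each such field is \<open>twist_field X\<close> with X in
  \<open>Der\<close>, and each axiom reduces to its counterpart for X.\<close>

lemma (in twisted_covariant_derivative) twist_covariant_derivative:
  "equivariant_covariant_derivative (twist_hopf H F) (twist_R H F R) A\<^sub>F M\<^sub>F
    (\<lambda>Y. nabla\<^sub>F (inv_into Der twist_field Y))"
proof (intro equivariant_covariant_derivative.intro equivariant_covariant_derivative_axioms.intro)
  let ?Der = "braided_vector_fields (twist_hopf H F) (twist_R H F R) A\<^sub>F"
  have inv [simp]: "inv_into Der twist_field (twist_field X) = X" if "X \<in> Der" for X
    using twist_field_bij that by (simp add: bij_betw_def inv_into_f_f)
  have field: "\<exists>X\<in>Der. Y = twist_field X" if "Y \<in> ?Der" for Y
    using twist_field_bij that by (auto simp: bij_betw_def)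
  show "equivariant_braided_symmetric_bimodule (twist_hopf H F) (twist_R H F R) A\<^sub>F M\<^sub>F"
    by (rule twist_bimodule)
  fix Y Z m and a :: 'a and c :: 'k and x :: 'h
  assume "Y \<in> ?Der"
  then obtain X where X: "X \<in> Der" and Y: "Y = twist_field X"
    using field by blast
  show "module_hom (mscale M\<^sub>F) (mscale M\<^sub>F) (nabla\<^sub>F (inv_into Der twist_field Y))"
    by (simp add: X Y twist_nabla_linear)
  show "nabla\<^sub>F (inv_into Der twist_field (\<lambda>a. ascale A\<^sub>F c (Y a))) m =
      mscale M\<^sub>F c (nabla\<^sub>F (inv_into Der twist_field Y) m)"
    by (simp add: X Y twist_nabla_scale Der_scale flip: twist_field_scale)
  show "mact M\<^sub>F x (nabla\<^sub>F (inv_into Der twist_field Y) m) = sweedler (comult (twist_hopf H F) x)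
      (\<lambda>u v. nabla\<^sub>F (inv_into Der twist_field (adjoint_action (twist_hopf H F) A\<^sub>F u Y)) (mact M\<^sub>F v m))"
    by (simp add: X Y twist_nabla_equivariant Der_ad adjoint_action_twist)
  show "nabla\<^sub>F (inv_into Der twist_field (\<lambda>b. amult A\<^sub>F a (Y b))) m =
      lmult M\<^sub>F a (nabla\<^sub>F (inv_into Der twist_field Y) m)"
    \<comment> \<open>The twisted multiple of Y is recognised as the image of the twisted multiple
      of X. That this preimage lies in \<open>Der\<close> is what allows \<open>inv_into\<close> to
      be evaluated.\<close>
    unfolding Y twist_field_lmult[OF X, symmetric]
    by (simp only: inv X Der_twist_lmult twist_nabla_lmult)
  show "nabla\<^sub>F (inv_into Der twist_field Y) (lmult M\<^sub>F a m) = lmult M\<^sub>F (Y a) m +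
      sweedler (inv2 (hscale (twist_hopf H F)) (twist_R H F R)) (\<lambda>u v. lmult M\<^sub>F (aact A\<^sub>F u a)
        (nabla\<^sub>F (inv_into Der twist_field (adjoint_action (twist_hopf H F) A\<^sub>F v Y)) m))"
    by (simp add: X Y twist_nabla_leibniz Der_ad adjoint_action_twist del: twist_bimodule_simps(3))
  assume "Z \<in> ?Der"
  then obtain X' where X': "X' \<in> Der" and Z: "Z = twist_field X'"
    using field by blast
  show "nabla\<^sub>F (inv_into Der twist_field (\<lambda>a. Y a + Z a)) m =
      nabla\<^sub>F (inv_into Der twist_field Y) m + nabla\<^sub>F (inv_into Der twist_field Z) m"
    by (simp add: X X' Y Z twist_nabla_add Der_add flip: twist_field_add)
qed

theorem proposition3p11:
  fixes H :: "('k::comm_ring_1, 'h::ring_1) hopf_data"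
    and R F :: "('h \<times> 'h) multiset set"
    and A :: "('k, 'h, 'a::ab_group_add) algebra_data"
    and M :: "('k, 'h, 'a, 'm::ab_group_add) bimodule_data"
    and nabla :: "('a \<Rightarrow> 'a) \<Rightarrow> 'm \<Rightarrow> 'm"
  assumes "triangular_hopf_algebra H R"
    and "braided_commutative_module_algebra H R A"
    and "equivariant_braided_symmetric_bimodule H R A M"
    and "equivariant_covariant_derivative H R A M nabla"
    and "drinfeld_twist H F"
  shows "bij_betw (twist_vector_field H F A) (braided_vector_fields H R A)
           (braided_vector_fields (twist_hopf H F) (twist_R H F R) (twist_algebra H F A)) \<and>
         equivariant_covariant_derivative
           (twist_hopf H F) (twist_R H F R) (twist_algebra H F A) (twist_bimodule H F A M)
           (\<lambda>Y. twist_nabla H F A M nabla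
              (inv_into (braided_vector_fields H R A) (twist_vector_field H F A) Y))"
proof -
  interpret twisted_covariant_derivative H R A M nabla F
    using assms by (intro twisted_covariant_derivative.intro)
  show ?thesis
    using twist_field_bij twist_covariant_derivative by blast
qed

end
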